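(* Let $\Gamma:\mathcal R'\to\mathcal D'$ be the operator of restriction from $\mathcal R$ to $\mathcal D$, and $\ker(\Gamma)=\{f\in\mathcal R':\Gamma(f)=0\}$. 1) Let $f\in\ker(\Gamma)$. Then there exist uniquely determined functions $c_f^k:I\to\mathbf C$, $t\mapsto c_f^k(t)$, $k\in\mathbf N_0$, such that for every $\varphi\in\mathcal R$ $$(f,\varphi)=\sum_{k\in\mathbf N_0}\sum_{t\in I}c_f^k(t)\,\sigma_t\bigl(\varphi^{(k)}\bigr),$$ where the distribution $\mathcal R\ni\varphi\mapsto\sum_{k\in\mathbf N_0}\sum_{t\in I}c_f^k(t)\sigma_t(\varphi^{(k)})$ is defined to be the (continuous linear) extension from $\mathcal R_F$ to $\mathcal R$ of the functional $$\mathcal R_F\ni\varphi\mapsto\sum_{k\in\mathbf N_0}\sum_{t\in I}c_f^k(t)\sigma_t\bigl(\varphi^{(k)}\bigr)$$ (for $\varphi\in\mathcal R_F$ only finitely many summands are non-zero). 2) If $f\in\ker(\Gamma)$ and $t\in I$, then $c_f^k(t)=0$ for all $k$ starting with a certain one. 3) If $f\in\ker(\Gamma)$ and $t\in I\setminus\operatorname{supp}(f)$, then $c_f^k(t)=0$ for all $k\in\mathbf N_0$.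
   Context: $I=(a,b)\subset\mathbf R$ is an open interval (e.g. $I=\mathbf R$), $\mathbf N_0=\mathbf N\cup\{0\}$; functions are identified when equal almost everywhere. $\mathbb G$ is the algebra of essentially bounded $g:I\to\mathbf C$ possessing both limits $g(t\pm)=\operatorname{ess\,lim}_{s\to t\pm}g(s)$ at every $t\in I$; $\sigma_t(g):=g(t+)-g(t-)$. $\mathbb G^\infty$ is the algebra of $g\in\mathbb G$ such that for every $k\in\mathbf N$ there is $g^{(k)}\in\mathbb G$ with $g^{(k)}(t\pm)=\operatorname{ess\,lim}_{s\to t\pm}\frac{g^{(k-1)}(s)-g^{(k-1)}(t\pm)}{s-t}$ for all $t\in I$ ($g^{(0)}=g$), with the norms $\|g\|_k=\max_{0\le i\le k}\|g^{(i)}\|_{L_\infty}$, $k\in\mathbf N_0$. For $g\in\mathbb G$, $\operatorname{supp}(g)$ is the closure in $I$ of $\{t: g(t-)\ne0\text{ or }g(t+)\ne0\}$. $\mathcal R$ is the space of $\varphi\in\mathbb G^\infty$ with compact support in $I$, with the locally convex inductive limit topology of the countably normed spaces $\{\varphi\in\mathbb G^\infty:\varphi=0\text{ outside }J\}$ (norms $\|\cdot\|_k$), $J$ running over bounded subintervals with $\bar J\subset I$. $\mathcal R'$ is the space of continuous linear functionals $f:\mathcal R\to\mathbf C$, $\varphi\mapsto(f,\varphi)$. $\mathcal D\subset\mathcal R$ is the classical space of compactly supported infinitely differentiable functions on $I$, $\mathcal D'$ its dual. For $f\in\mathcal R'$, $\operatorname{supp}(f)\subset I$ is the minimal closed set such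 that $(f,\varphi)=0$ for every $\varphi\in\mathcal R$ with $\operatorname{supp}(\varphi)\cap\operatorname{supp}(f)=\varnothing$. Let $\mathbb C$ be the bounded continuous functions on $I$; $\mathbb F_k\subset\mathbb G^\infty$ is the set of $g$ with $g^{(i)}\in\mathbb C$ for all $i\ne k$ and $g^{(k)}$ piecewise continuous (locally finitely many discontinuities); $\mathbb F$ is the linear span of all $\mathbb F_k$, $k\in\mathbf N_0$; $\mathcal R_F=\mathcal R\cap\mathbb F$ with the topology induced from $\mathcal R$. $\mathcal R_F$ is dense in $\mathcal R$, so continuous extensions from $\mathcal R_F$ to $\mathcal R$ are unique. *)

theory Defs
  imports "HOL-Analysis.Analysis" "HOL-Probability.Essential_Supremum"
begin

text \<open>
  Functions on the open set \<open>I\<close> that agree almost everywhere are identified. This is encoded through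
  representatives \<open>real \<Rightarrow> complex\<close>, whose values outside \<open>I\<close> are irrelevant: every notion
  below depends only on the class of a function modulo equality almost everywhere on \<open>I\<close>, and
  functionals are required to respect that equality.
\<close>

definition ae_eq :: "real set \<Rightarrow> (real \<Rightarrow> complex) \<Rightarrow> (real \<Rightarrow> complex) \<Rightarrow> bool" where
  "ae_eq I g h \<longleftrightarrow> (AE t in lebesgue. t \<in> I \<longrightarrow> g t = h t)"

subsection \<open>Regulated functions\<close>

text \<open>
  Convergence along \<open>inf (at_right t) (ae_filter lebesgue)\<close> is the essential limit from the right:
  a property holds eventually iff, for some \<open>\<delta> > 0\<close>, it holds almost everywhere on
  \<open>{t<..<t + \<delta>}\<close>.
\<close>

abbreviation ess_right :: "real \<Rightarrow> real filter" where
  "ess_right t \<equiv> inf (at_right t) (ae_filter lebesgue)"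

abbreviation ess_left :: "real \<Rightarrow> real filter" where
  "ess_left t \<equiv> inf (at_left t) (ae_filter lebesgue)"

definition rlim :: "(real \<Rightarrow> complex) \<Rightarrow> real \<Rightarrow> complex" where
  "rlim g t = Lim (ess_right t) g"

definition llim :: "(real \<Rightarrow> complex) \<Rightarrow> real \<Rightarrow> complex" where
  "llim g t = Lim (ess_left t) g"

definition jump :: "real \<Rightarrow> (real \<Rightarrow> complex) \<Rightarrow> complex" where
  "jump t g = rlim g t - llim g t"

definition ess_norm :: "real set \<Rightarrow> (real \<Rightarrow> complex) \<Rightarrow> ereal" where
  "ess_norm I g = esssup (lebesgue_on I) (\<lambda>t. ereal (cmod (g t)))"

definition GG :: "real set \<Rightarrow> (real \<Rightarrow> complex) set" where
  "GG I = {g. g \<in> borel_measurable (lebesgue_on I) \<and> ess_norm I g < \<infinity> \<and>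
      (\<forall>t\<in>I. (\<exists>L. (g \<longlongrightarrow> L) (ess_right t)) \<and> (\<exists>L. (g \<longlongrightarrow> L) (ess_left t)))}"

definition GG_supp :: "real set \<Rightarrow> (real \<Rightarrow> complex) \<Rightarrow> real set" where
  "GG_supp I g = top_of_set I closure_of {t \<in> I. llim g t \<noteq> 0 \<or> rlim g t \<noteq> 0}"

subsection \<open>Derivatives\<close>

definition has_GG_deriv :: "real set \<Rightarrow> (real \<Rightarrow> complex) \<Rightarrow> (real \<Rightarrow> complex) \<Rightarrow> bool" where
  "has_GG_deriv I g h \<longleftrightarrow> h \<in> GG I \<and> (\<forall>t\<in>I.
      ((\<lambda>s. (g s - rlim g t) / of_real (s - t)) \<longlongrightarrow> rlim h t) (ess_right t) \<and>
      ((\<lambda>s. (g s - llim g t) / of_real (s - t)) \<longlongrightarrow> llim h t) (ess_left t))"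

definition GG_deriv_seq :: "real set \<Rightarrow> (real \<Rightarrow> complex) \<Rightarrow> (nat \<Rightarrow> real \<Rightarrow> complex) \<Rightarrow> bool" where
  "GG_deriv_seq I g d \<longleftrightarrow> d 0 = g \<and> (\<forall>k. has_GG_deriv I (d k) (d (Suc k)))"

definition GG_inf :: "real set \<Rightarrow> (real \<Rightarrow> complex) set" where
  "GG_inf I = {g \<in> GG I. \<exists>d. GG_deriv_seq I g d}"

text \<open>The choice below is immaterial: the derivatives are determined almost everywhere on \<open>I\<close>.\<close>

definition GG_deriv :: "real set \<Rightarrow> nat \<Rightarrow> (real \<Rightarrow> complex) \<Rightarrow> real \<Rightarrow> complex" where
  "GG_deriv I k g = (SOME d. GG_deriv_seq I g d) k"

definition GG_norm :: "real set \<Rightarrow> nat \<Rightarrow> (real \<Rightarrow> complex) \<Rightarrow> ereal" where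
  "GG_norm I k g = Max ((\<lambda>i. ess_norm I (GG_deriv I i g)) ` {..k})"

subsection \<open>The test function space and its dual\<close>

definition RR :: "real set \<Rightarrow> (real \<Rightarrow> complex) set" where
  "RR I = {\<phi> \<in> GG_inf I. compact (GG_supp I \<phi>)}"

definition GG_inf_on :: "real set \<Rightarrow> real set \<Rightarrow> (real \<Rightarrow> complex) set" where
  "GG_inf_on I J = {\<phi> \<in> GG_inf I. ae_eq (I - J) \<phi> (\<lambda>t. 0)}"

definition abs_convex :: "(real \<Rightarrow> complex) set \<Rightarrow> bool" where
  "abs_convex V \<longleftrightarrow> (\<forall>\<phi>\<in>V. \<forall>\<psi>\<in>V. \<forall>\<alpha> \<beta>. cmod \<alpha> + cmod \<beta> \<le> 1 \<longrightarrow>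
      (\<lambda>t. \<alpha> * \<phi> t + \<beta> * \<psi> t) \<in> V)"

text \<open>
  The absolutely convex sets whose trace on each step \<open>GG_inf_on I J\<close> is a neighbourhood of \<open>0\<close>
  there; their traces on \<open>RR I\<close> form a base of neighbourhoods of \<open>0\<close> for the locally convex
  inductive limit topology.
\<close>

definition RR_nhd0 :: "real set \<Rightarrow> (real \<Rightarrow> complex) set \<Rightarrow> bool" where
  "RR_nhd0 I V \<longleftrightarrow> abs_convex V \<and>
     (\<forall>J. is_interval J \<and> bounded J \<and> closure J \<subseteq> I \<longrightarrow>
        (\<exists>k. \<exists>\<epsilon>>0. {\<phi> \<in> GG_inf_on I J. GG_norm I k \<phi> < ereal \<epsilon>} \<subseteq> V))"

definition RR_open :: "real set \<Rightarrow> (real \<Rightarrow> complex) set \<Rightarrow> bool" where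
  "RR_open I U \<longleftrightarrow> U \<subseteq> RR I \<and>
     (\<forall>\<phi>\<in>U. \<exists>V. RR_nhd0 I V \<and> (\<forall>\<psi>\<in>RR I. (\<lambda>t. \<psi> t - \<phi> t) \<in> V \<longrightarrow> \<psi> \<in> U))"

definition RR_topology :: "real set \<Rightarrow> (real \<Rightarrow> complex) topology" where
  "RR_topology I = topology (RR_open I)"

lemma GG_norm_mono: "k \<le> l \<Longrightarrow> GG_norm I k \<phi> \<le> GG_norm I l \<phi>"
  unfolding GG_norm_def by (rule Max_mono) auto

lemma RR_nhd0_Int:
  assumes "RR_nhd0 I V" "RR_nhd0 I W"
  shows "RR_nhd0 I (V \<inter> W)"
  unfolding RR_nhd0_def
proof (intro conjI allI impI)
  show "abs_convex (V \<inter> W)"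
    using assms unfolding RR_nhd0_def abs_convex_def by blast
next
  fix J assume J: "is_interval J \<and> bounded J \<and> closure J \<subseteq> I"
  obtain k \<epsilon> where V: "\<epsilon> > 0" "{\<phi> \<in> GG_inf_on I J. GG_norm I k \<phi> < ereal \<epsilon>} \<subseteq> V"
    using assms(1) J unfolding RR_nhd0_def by blast
  obtain l \<delta> where W: "\<delta> > 0" "{\<phi> \<in> GG_inf_on I J. GG_norm I l \<phi> < ereal \<delta>} \<subseteq> W"
    using assms(2) J unfolding RR_nhd0_def by blast
  have "{\<phi> \<in> GG_inf_on I J. GG_norm I (max k l) \<phi> < ereal (min \<epsilon> \<delta>)} \<subseteq> V \<inter> W"
  proof
    fix \<phi> assume *: "\<phi> \<in> {\<phi> \<in> GG_inf_on I J. GG_norm I (max k l) \<phi> < ereal (min \<epsilon> \<delta>)}"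
    then have "GG_norm I (max k l) \<phi> < ereal \<epsilon>" "GG_norm I (max k l) \<phi> < ereal \<delta>"
      by (auto simp: min_def split: if_splits intro: less_le_trans)
    with GG_norm_mono[of k "max k l" I \<phi>] GG_norm_mono[of l "max k l" I \<phi>]
    have "GG_norm I k \<phi> < ereal \<epsilon>" "GG_norm I l \<phi> < ereal \<delta>"
      by (auto intro: le_less_trans)
    with * V(2) W(2) show "\<phi> \<in> V \<inter> W" by blast
  qed
  moreover have "min \<epsilon> \<delta> > 0" using V(1) W(1) by simp
  ultimately show "\<exists>k. \<exists>\<epsilon>>0. {\<phi> \<in> GG_inf_on I J. GG_norm I k \<phi> < ereal \<epsilon>} \<subseteq> V \<inter> W"
    by blast
qed

lemma istopology_RR_open: "istopology (RR_open I)"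
  unfolding istopology_def
proof (intro conjI allI impI)
  fix S T assume S: "RR_open I S" and T: "RR_open I T"
  show "RR_open I (S \<inter> T)"
    unfolding RR_open_def
  proof (intro conjI ballI)
    show "S \<inter> T \<subseteq> RR I" using S unfolding RR_open_def by blast
    fix \<phi> assume "\<phi> \<in> S \<inter> T"
    then obtain V W where
      "RR_nhd0 I V" "\<forall>\<psi>\<in>RR I. (\<lambda>t. \<psi> t - \<phi> t) \<in> V \<longrightarrow> \<psi> \<in> S"
      "RR_nhd0 I W" "\<forall>\<psi>\<in>RR I. (\<lambda>t. \<psi> t - \<phi> t) \<in> W \<longrightarrow> \<psi> \<in> T"
      using S T unfolding RR_open_def by blast
    then show "\<exists>V. RR_nhd0 I V \<and> (\<forall>\<psi>\<in>RR I. (\<lambda>t. \<psi> t - \<phi> t) \<in> V \<longrightarrow> \<psi> \<in> S \<inter> T)"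
      by (intro exI[of _ "V \<inter> W"]) (auto intro: RR_nhd0_Int)
  qed
next
  fix K assume K: "\<forall>S\<in>K. RR_open I S"
  show "RR_open I (\<Union>K)"
    unfolding RR_open_def
  proof (intro conjI ballI)
    show "\<Union>K \<subseteq> RR I" using K unfolding RR_open_def by blast
    fix \<phi> assume "\<phi> \<in> \<Union>K"
    then obtain S where S: "S \<in> K" "\<phi> \<in> S" by blast
    with K obtain V where "RR_nhd0 I V" "\<forall>\<psi>\<in>RR I. (\<lambda>t. \<psi> t - \<phi> t) \<in> V \<longrightarrow> \<psi> \<in> S"
      unfolding RR_open_def by blast
    with S show "\<exists>V. RR_nhd0 I V \<and> (\<forall>\<psi>\<in>RR I. (\<lambda>t. \<psi> t - \<phi> t) \<in> V \<longrightarrow> \<psi> \<in> \<Union>K)"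
      by blast
  qed
qed

lemma openin_RR_topology: "openin (RR_topology I) U \<longleftrightarrow> RR_open I U"
  unfolding RR_topology_def by (simp add: topology_inverse'[OF istopology_RR_open])

lemma RR_nhd0_UNIV: "RR_nhd0 I UNIV"
  unfolding RR_nhd0_def abs_convex_def by (auto intro: exI[of _ 1])

lemma topspace_RR_topology [simp]: "topspace (RR_topology I) = RR I"
proof (rule antisym)
  show "topspace (RR_topology I) \<subseteq> RR I"
    using openin_topspace[of "RR_topology I"] unfolding openin_RR_topology RR_open_def by blast
  have "openin (RR_topology I) (RR I)"
    unfolding openin_RR_topology RR_open_def using RR_nhd0_UNIV by blast
  then show "RR I \<subseteq> topspace (RR_topology I)" by (rule openin_subset)
qed

text \<open>The values of a functional outside \<open>RR I\<close> are irrelevant.\<close>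

definition RR_dual :: "real set \<Rightarrow> ((real \<Rightarrow> complex) \<Rightarrow> complex) set" where
  "RR_dual I = {f.
      (\<forall>\<phi>\<in>RR I. \<forall>\<psi>\<in>RR I. ae_eq I \<phi> \<psi> \<longrightarrow> f \<phi> = f \<psi>) \<and>
      (\<forall>\<phi>\<in>RR I. \<forall>\<psi>\<in>RR I. f (\<lambda>t. \<phi> t + \<psi> t) = f \<phi> + f \<psi>) \<and>
      (\<forall>\<alpha>. \<forall>\<phi>\<in>RR I. f (\<lambda>t. \<alpha> * \<phi> t) = \<alpha> * f \<phi>) \<and>
      continuous_map (RR_topology I) euclidean f}"

definition RR_dual_supp :: "real set \<Rightarrow> ((real \<Rightarrow> complex) \<Rightarrow> complex) \<Rightarrow> real set" where
  "RR_dual_supp I f = (LEAST S. closedin (top_of_set I) S \<and>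
      (\<forall>\<phi>\<in>RR I. GG_supp I \<phi> \<inter> S = {} \<longrightarrow> f \<phi> = 0))"

subsection \<open>Restriction to smooth test functions\<close>

definition DD :: "real set \<Rightarrow> (real \<Rightarrow> complex) set" where
  "DD I = {\<phi>.
      (\<exists>d. d 0 = \<phi> \<and> (\<forall>k::nat. \<forall>t\<in>I. (d k has_vector_derivative d (Suc k) t) (at t))) \<and>
      (\<exists>K. compact K \<and> K \<subseteq> I \<and> (\<forall>t\<in>I - K. \<phi> t = 0))}"

definition Gam :: "real set \<Rightarrow> ((real \<Rightarrow> complex) \<Rightarrow> complex) \<Rightarrow> (real \<Rightarrow> complex) \<Rightarrow> complex" where
  "Gam I f = restrict f (DD I)"

definition ker_Gam :: "real set \<Rightarrow> ((real \<Rightarrow> complex) \<Rightarrow> complex) set" where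
  "ker_Gam I = {f \<in> RR_dual I. Gam I f = (\<lambda>\<phi>\<in>DD I. 0)}"

subsection \<open>Test functions with finitely many jumps\<close>

definition bdd_cont :: "real set \<Rightarrow> (real \<Rightarrow> complex) set" where
  "bdd_cont I = {g. \<exists>h. ae_eq I g h \<and> continuous_on I h \<and> bounded (h ` I)}"

definition piecewise_cont :: "real set \<Rightarrow> (real \<Rightarrow> complex) set" where
  "piecewise_cont I = {g. \<exists>h. ae_eq I g h \<and>
      (\<forall>K. compact K \<and> K \<subseteq> I \<longrightarrow> finite {t \<in> K. \<not> isCont h t})}"

definition FF_at :: "real set \<Rightarrow> nat \<Rightarrow> (real \<Rightarrow> complex) set" where
  "FF_at I k = {g \<in> GG_inf I. (\<forall>i. i \<noteq> k \<longrightarrow> GG_deriv I i g \<in> bdd_cont I) \<and>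
      GG_deriv I k g \<in> piecewise_cont I}"

definition FF :: "real set \<Rightarrow> (real \<Rightarrow> complex) set" where
  "FF I = {g. \<exists>S \<alpha>. finite S \<and> S \<subseteq> (\<Union>k. FF_at I k) \<and> g = (\<lambda>t. \<Sum>h\<in>S. \<alpha> h * h t)}"

definition RR_F :: "real set \<Rightarrow> (real \<Rightarrow> complex) set" where
  "RR_F I = RR I \<inter> FF I"

subsection \<open>Sums of jumps\<close>

definition jump_terms ::
  "real set \<Rightarrow> (nat \<Rightarrow> real \<Rightarrow> complex) \<Rightarrow> (real \<Rightarrow> complex) \<Rightarrow> (nat \<times> real) set" where
  "jump_terms I c \<phi> = {(k, t). t \<in> I \<and> c k t * jump t (GG_deriv I k \<phi>) \<noteq> 0}"

definition jump_sum ::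
  "real set \<Rightarrow> (nat \<Rightarrow> real \<Rightarrow> complex) \<Rightarrow> (real \<Rightarrow> complex) \<Rightarrow> complex" where
  "jump_sum I c \<phi> = (\<Sum>(k, t)\<in>jump_terms I c \<phi>. c k t * jump t (GG_deriv I k \<phi>))"

definition continuous_extension ::
  "real set \<Rightarrow> ((real \<Rightarrow> complex) \<Rightarrow> complex) \<Rightarrow> ((real \<Rightarrow> complex) \<Rightarrow> complex) \<Rightarrow> bool" where
  "continuous_extension I T F \<longleftrightarrow> F \<in> RR_dual I \<and> (\<forall>\<phi>\<in>RR_F I. F \<phi> = T \<phi>)"

text \<open>
  \<open>f\<close> is on \<open>RR I\<close> the distribution given by the formal sum of the \<open>c k t\<close>-multiples of the
  jumps, i.e. the extension of \<open>jump_sum I c\<close> from the dense subspace \<open>RR_F I\<close>.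
\<close>

definition jump_expansion ::
  "real set \<Rightarrow> ((real \<Rightarrow> complex) \<Rightarrow> complex) \<Rightarrow> (nat \<Rightarrow> real \<Rightarrow> complex) \<Rightarrow> bool" where
  "jump_expansion I f c \<longleftrightarrow>
     (\<exists>F. continuous_extension I (jump_sum I c) F \<and> (\<forall>\<phi>\<in>RR I. f \<phi> = F \<phi>))"

end

theory Submission
  imports Defs
begin

text \<open>
  An element of \<open>RR I\<close> all of whose derivatives have no jumps is almost everywhere equal to a smooth
  function, so \<open>f \<in> ker_Gam I\<close> kills it and \<open>f \<phi>\<close> depends only on the jumps of \<open>\<phi>\<close>. Let
  \<open>jump_fun t \<epsilon> k\<close> be \<open>(s - t)\<^sup>k / k!\<close> for \<open>s > t\<close>, smoothly cut off at distance of order \<open>\<epsilon>\<close>; its only jump is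
  a unit jump of the \<open>k\<close>-th derivative at \<open>t\<close>. Subtracting the matching combination of jump functions
  from \<open>\<phi> \<in> RR_F I\<close> shows that \<open>c k t = f (jump_fun t \<epsilon> k)\<close> gives the expansion, and evaluating an
  expansion at a jump function shows that this choice is forced, for every \<open>\<epsilon>\<close>. As \<open>\<epsilon> \<rightarrow> 0\<close>, the
  derivatives of \<open>jump_fun t \<epsilon> k\<close> of order less than \<open>k\<close> tend to \<open>0\<close> uniformly, so \<open>c k t = 0\<close> once
  \<open>k\<close> exceeds the order of \<open>f\<close> near \<open>t\<close>. For the support one needs that the least closed set exists; since \<open>RR I\<close> is stable
  under multiplication with indicators of half-lines, a bisection replaces the partition of unity.
\<close>

subsection \<open>Essential one-sided limits\<close>

lemma eventually_ess_right:
  "eventually P (ess_right t) \<longleftrightarrow> (\<exists>\<delta>>0. AE s in lebesgue. t < s \<and> s < t + \<delta> \<longrightarrow> P s)"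
proof
  assume "eventually P (ess_right t)"
  then obtain Q R where QR: "eventually Q (at_right t)" "eventually R (ae_filter lebesgue)"
    "\<And>s. Q s \<and> R s \<Longrightarrow> P s" unfolding eventually_inf by blast
  from QR(1) obtain b where b: "b > t" "\<And>s. t < s \<Longrightarrow> s < b \<Longrightarrow> Q s"
    unfolding eventually_at_right_field by blast
  have "AE s in lebesgue. t < s \<and> s < t + (b - t) \<longrightarrow> P s"
    using QR(2) by eventually_elim (use b QR(3) in auto)
  then show "\<exists>\<delta>>0. AE s in lebesgue. t < s \<and> s < t + \<delta> \<longrightarrow> P s"
    using b(1) by (intro exI[of _ "b - t"]) auto
next
  assume "\<exists>\<delta>>0. AE s in lebesgue. t < s \<and> s < t + \<delta> \<longrightarrow> P s"
  then obtain \<delta> where "\<delta> > 0" "AE s in lebesgue. t < s \<and> s < t + \<delta> \<longrightarrow> P s" by blast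
  then show "eventually P (ess_right t)"
    unfolding eventually_inf eventually_at_right_field
    by (intro exI[of _ "\<lambda>s. t < s \<and> s < t + \<delta>"] exI[of _ "\<lambda>s. t < s \<and> s < t + \<delta> \<longrightarrow> P s"])
       (auto intro!: exI[of _ "t + \<delta>"])
qed

lemma eventually_ess_left:
  "eventually P (ess_left t) \<longleftrightarrow> (\<exists>\<delta>>0. AE s in lebesgue. t - \<delta> < s \<and> s < t \<longrightarrow> P s)"
proof
  assume "eventually P (ess_left t)"
  then obtain Q R where QR: "eventually Q (at_left t)" "eventually R (ae_filter lebesgue)"
    "\<And>s. Q s \<and> R s \<Longrightarrow> P s" unfolding eventually_inf by blast
  from QR(1) obtain b where b: "b < t" "\<And>s. b < s \<Longrightarrow> s < t \<Longrightarrow> Q s"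
    unfolding eventually_at_left_field by blast
  have "AE s in lebesgue. t - (t - b) < s \<and> s < t \<longrightarrow> P s"
    using QR(2) by eventually_elim (use b QR(3) in auto)
  then show "\<exists>\<delta>>0. AE s in lebesgue. t - \<delta> < s \<and> s < t \<longrightarrow> P s"
    using b(1) by (intro exI[of _ "t - b"]) auto
next
  assume "\<exists>\<delta>>0. AE s in lebesgue. t - \<delta> < s \<and> s < t \<longrightarrow> P s"
  then obtain \<delta> where "\<delta> > 0" "AE s in lebesgue. t - \<delta> < s \<and> s < t \<longrightarrow> P s" by blast
  then show "eventually P (ess_left t)"
    unfolding eventually_inf eventually_at_left_field
    by (intro exI[of _ "\<lambda>s. t - \<delta> < s \<and> s < t"] exI[of _ "\<lambda>s. t - \<delta> < s \<and> s < t \<longrightarrow> P s"])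
       (auto intro!: exI[of _ "t - \<delta>"])
qed

text \<open>A nondegenerate interval is not a null set. Hence the essential one-sided filters are
  proper and limits along them are unique.\<close>

lemma AE_lebesgue_interval_ex:
  fixes u v :: real
  assumes "u < v" "AE s in lebesgue. u < s \<and> s < v \<longrightarrow> P s"
  shows "\<exists>s. u < s \<and> s < v \<and> P s"
proof (rule ccontr)
  assume "\<not> ?thesis"
  with assms(2) have "AE s in lebesgue. s \<notin> {u<..<v}"
    by (elim AE_mp) (auto intro!: AE_I2)
  then have "{u<..<v} \<in> null_sets lebesgue"
    by (simp add: AE_iff_null_sets)
  with assms(1) show False
    by (simp add: null_sets_def)
qed

lemma ess_right_neq_bot [simp]: "ess_right t \<noteq> bot"
  unfolding trivial_limit_def eventually_ess_right
  using AE_lebesgue_interval_ex[of t "t + \<delta>" "\<lambda>_. False" for \<delta>] by fastforce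

lemma ess_left_neq_bot [simp]: "ess_left t \<noteq> bot"
  unfolding trivial_limit_def eventually_ess_left
  using AE_lebesgue_interval_ex[of "t - \<delta>" t "\<lambda>_. False" for \<delta>] by fastforce

lemma rlim_eqI: "(g \<longlongrightarrow> L) (ess_right t) \<Longrightarrow> rlim g t = L"
  unfolding rlim_def by (rule tendsto_Lim) simp_all

lemma llim_eqI: "(g \<longlongrightarrow> L) (ess_left t) \<Longrightarrow> llim g t = L"
  unfolding llim_def by (rule tendsto_Lim) simp_all

lemma rlim_const [simp]: "rlim (\<lambda>_. c) t = c"
  by (rule rlim_eqI) simp

lemma llim_const [simp]: "llim (\<lambda>_. c) t = c"
  by (rule llim_eqI) simp

lemma Lim_eventually_cong: "eventually (\<lambda>s. g s = h s) F \<Longrightarrow> Lim F g = Lim F h"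
  unfolding Topological_Spaces.Lim_def using tendsto_cong by metis

lemma rlim_cong: "eventually (\<lambda>s. g s = h s) (ess_right t) \<Longrightarrow> rlim g t = rlim h t"
  unfolding rlim_def by (rule Lim_eventually_cong)

lemma llim_cong: "eventually (\<lambda>s. g s = h s) (ess_left t) \<Longrightarrow> llim g t = llim h t"
  unfolding llim_def by (rule Lim_eventually_cong)

lemma AE_eventually_ess:
  assumes "open I" "t \<in> I" "AE s in lebesgue. s \<in> I \<longrightarrow> P s"
  shows "eventually P (ess_right t)" "eventually P (ess_left t)"
proof -
  obtain e where e: "e > 0" "ball t e \<subseteq> I"
    using assms(1,2) openE by blast
  have "AE s in lebesgue. t < s \<and> s < t + e \<longrightarrow> P s"
    using assms(3) by eventually_elim (use e in \<open>auto simp: subset_iff dist_real_def\<close>)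
  then show "eventually P (ess_right t)" unfolding eventually_ess_right using e by blast
  have "AE s in lebesgue. t - e < s \<and> s < t \<longrightarrow> P s"
    using assms(3) by eventually_elim (use e in \<open>auto simp: subset_iff dist_real_def\<close>)
  then show "eventually P (ess_left t)" unfolding eventually_ess_left using e by blast
qed

lemma ae_eq_refl [simp]: "ae_eq I g g"
  unfolding ae_eq_def by auto

lemma ae_eq_eventually:
  assumes "open I" "t \<in> I" "ae_eq I g h"
  shows "eventually (\<lambda>s. g s = h s) (ess_right t)" "eventually (\<lambda>s. g s = h s) (ess_left t)"
  using AE_eventually_ess[of I t] assms unfolding ae_eq_def by auto

lemma ae_eq_rlim: "open I \<Longrightarrow> t \<in> I \<Longrightarrow> ae_eq I g h \<Longrightarrow> rlim g t = rlim h t"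
  by (intro rlim_cong ae_eq_eventually)

lemma ae_eq_llim: "open I \<Longrightarrow> t \<in> I \<Longrightarrow> ae_eq I g h \<Longrightarrow> llim g t = llim h t"
  by (intro llim_cong ae_eq_eventually)

lemma ae_eq_jump: "open I \<Longrightarrow> t \<in> I \<Longrightarrow> ae_eq I g h \<Longrightarrow> jump t g = jump t h"
  unfolding jump_def using ae_eq_rlim ae_eq_llim by metis

lemma ess_right_le_at: "ess_right t \<le> at t"
  by (meson at_le inf.coboundedI1 top_greatest)

lemma ess_left_le_at: "ess_left t \<le> at t"
  by (meson at_le inf.coboundedI1 top_greatest)

lemma isCont_rlim_llim:
  assumes "isCont g t"
  shows "rlim g t = g t" "llim g t = g t"
  using assms tendsto_mono[OF ess_right_le_at] tendsto_mono[OF ess_left_le_at]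
  by (auto intro!: rlim_eqI llim_eqI simp: isCont_def)

section \<open>Regulated functions and their right-limit representative\<close>

lemma AE_lebesgue_on_open:
  fixes I :: "real set"
  assumes "open I"
  shows "(AE t in lebesgue_on I. P t) \<longleftrightarrow> (AE t in lebesgue. t \<in> I \<longrightarrow> P t)"
  using assms by (intro AE_restrict_space_iff) auto

lemma GG_iff:
  assumes "open I"
  shows "g \<in> GG I \<longleftrightarrow> g \<in> borel_measurable (lebesgue_on I) \<and>
    (\<exists>B. AE t in lebesgue. t \<in> I \<longrightarrow> cmod (g t) \<le> B) \<and>
    (\<forall>t\<in>I. (g \<longlongrightarrow> rlim g t) (ess_right t) \<and> (g \<longlongrightarrow> llim g t) (ess_left t))"
proof -
  have "ess_norm I g < \<infinity> \<longleftrightarrow> (\<exists>B. AE t in lebesgue. t \<in> I \<longrightarrow> cmod (g t) \<le> B)"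
    if g: "g \<in> borel_measurable (lebesgue_on I)"
  proof
    assume *: "ess_norm I g < \<infinity>"
    then obtain B where B: "ess_norm I g < ereal B"
      using less_PInf_Ex_of_nat by auto
    have "AE t in lebesgue_on I. ereal (cmod (g t)) \<le> ess_norm I g"
      unfolding ess_norm_def by (rule esssup_AE)
    then have "AE t in lebesgue_on I. cmod (g t) \<le> B"
    proof eventually_elim
      case (elim t)
      then have "ereal (cmod (g t)) < ereal B" using B by (rule le_less_trans)
      then show ?case by simp
    qed
    then show "\<exists>B. AE t in lebesgue. t \<in> I \<longrightarrow> cmod (g t) \<le> B"
      unfolding AE_lebesgue_on_open[OF assms] by blast
  next
    assume "\<exists>B. AE t in lebesgue. t \<in> I \<longrightarrow> cmod (g t) \<le> B"
    then obtain B where "AE t in lebesgue_on I. ereal (cmod (g t)) \<le> ereal B"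
      unfolding AE_lebesgue_on_open[OF assms] by auto
    then have "ess_norm I g \<le> ereal B"
      unfolding ess_norm_def by (intro esssup_I) (use g in auto)
    then show "ess_norm I g < \<infinity>" by (auto simp: less_top[symmetric] top_ereal_def)
  qed
  moreover have "(\<exists>L. (g \<longlongrightarrow> L) (ess_right t)) \<longleftrightarrow> (g \<longlongrightarrow> rlim g t) (ess_right t)"
    "(\<exists>L. (g \<longlongrightarrow> L) (ess_left t)) \<longleftrightarrow> (g \<longlongrightarrow> llim g t) (ess_left t)" for t
    using rlim_eqI llim_eqI by metis+
  ultimately show ?thesis unfolding GG_def by auto
qed

lemma GG_tendsto:
  assumes "open I" "g \<in> GG I" "t \<in> I"
  shows "(g \<longlongrightarrow> rlim g t) (ess_right t)" "(g \<longlongrightarrow> llim g t) (ess_left t)"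
  using assms by (auto simp: GG_iff)

text \<open>Every \<open>s\<close> with \<open>u \<le> s < v\<close> has a right neighbourhood
  inside the interval, and non-strict estimates survive limits. An almost-everywhere estimate for
  \<open>g\<close> thus becomes a pointwise one for \<open>rlim g\<close>.\<close>

lemma rlim_near:
  assumes g: "open I" "g \<in> GG I" "s \<in> I" and s: "u \<le> s" "s < v"
    and AE: "AE x in lebesgue. u < x \<and> x < v \<longrightarrow> dist (g x) L \<le> e"
  shows "dist (rlim g s) L \<le> e"
proof -
  have "AE x in lebesgue. s < x \<and> x < s + (v - s) \<longrightarrow> dist (g x) L \<le> e"
    using AE by eventually_elim (use s in auto)
  then have "\<forall>\<^sub>F x in ess_right s. dist (g x) L \<le> e"
    unfolding eventually_ess_right using s by (intro exI[of _ "v - s"]) auto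
  then show ?thesis
    by (intro tendsto_upperbound[OF tendsto_dist[OF GG_tendsto(1)[OF g] tendsto_const]]) simp_all
qed

text \<open>Collects on one common radius what the two one-sided limits at \<open>t\<close> say
  about \<open>g\<close> and, through \<open>rlim_near\<close>, about \<open>rlim g\<close>. Left of
  \<open>t\<close> the function \<open>rlim g\<close> is compared with \<open>llim g t\<close>,
  because small right neighbourhoods of such points still lie left of \<open>t\<close>.\<close>

lemma GG_local:
  assumes g: "open I" "g \<in> GG I" and t: "t \<in> I" and "e > 0"
  obtains \<delta> where "\<delta> > 0" "ball t \<delta> \<subseteq> I"
    "\<forall>s. t < s \<and> s < t + \<delta> \<longrightarrow> dist (rlim g s) (rlim g t) \<le> e"
    "\<forall>s. t - \<delta> < s \<and> s < t \<longrightarrow> dist (rlim g s) (llim g t) \<le> e"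
    "AE s in lebesgue. t < s \<and> s < t + \<delta> \<longrightarrow> dist (g s) (rlim g t) \<le> e"
    "AE s in lebesgue. t - \<delta> < s \<and> s < t \<longrightarrow> dist (g s) (llim g t) \<le> e"
proof -
  obtain d0 where d0: "d0 > 0" "ball t d0 \<subseteq> I"
    using g(1) t openE by blast
  have "\<forall>\<^sub>F s in ess_right t. dist (g s) (rlim g t) < e"
    using GG_tendsto(1)[OF g t] \<open>e > 0\<close> by (auto simp: tendsto_iff)
  then obtain d1 where d1: "d1 > 0"
    "AE s in lebesgue. t < s \<and> s < t + d1 \<longrightarrow> dist (g s) (rlim g t) < e"
    unfolding eventually_ess_right by blast
  have "\<forall>\<^sub>F s in ess_left t. dist (g s) (llim g t) < e"
    using GG_tendsto(2)[OF g t] \<open>e > 0\<close> by (auto simp: tendsto_iff)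
  then obtain d2 where d2: "d2 > 0"
    "AE s in lebesgue. t - d2 < s \<and> s < t \<longrightarrow> dist (g s) (llim g t) < e"
    unfolding eventually_ess_left by blast
  define \<delta> where "\<delta> = min d0 (min d1 d2)"
  have \<delta>: "\<delta> > 0" "ball t \<delta> \<subseteq> I" using d0 d1 d2 by (auto simp: \<delta>_def subset_iff)
  have R: "AE s in lebesgue. t < s \<and> s < t + \<delta> \<longrightarrow> dist (g s) (rlim g t) \<le> e"
    using d1(2) by eventually_elim (auto simp: \<delta>_def)
  have L: "AE s in lebesgue. t - \<delta> < s \<and> s < t \<longrightarrow> dist (g s) (llim g t) \<le> e"
    using d2(2) by eventually_elim (auto simp: \<delta>_def)
  show thesis
  proof (rule that[OF \<delta> _ _ R L])
    show "\<forall>s. t < s \<and> s < t + \<delta> \<longrightarrow> dist (rlim g s) (rlim g t) \<le> e"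
      using \<delta> by (intro allI impI rlim_near[OF g _ _ _ R]) (auto simp: subset_iff dist_real_def)
    show "\<forall>s. t - \<delta> < s \<and> s < t \<longrightarrow> dist (rlim g s) (llim g t) \<le> e"
      using \<delta> by (intro allI impI rlim_near[OF g _ _ _ L]) (auto simp: subset_iff dist_real_def)
  qed
qed

text \<open>Near every point, \<open>g\<close> and \<open>rlim g\<close> both lie within
  \<open>e\<close> of the same one-sided limit, so they differ by at most \<open>2 * e\<close>
  almost everywhere there. Countably many such neighbourhoods cover \<open>I\<close>, and then
  \<open>e\<close> runs through a null sequence. This makes \<open>rlim g\<close> a canonical
  representative of the class of \<open>g\<close>.\<close>

lemma GG_ae_rlim:
  assumes g: "open I" "g \<in> GG I"
  shows "AE t in lebesgue. t \<in> I \<longrightarrow> g t = rlim g t"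
proof -
  have *: "AE s in lebesgue. s \<in> I \<longrightarrow> dist (g s) (rlim g s) \<le> 2 * e" if e: "e > 0" for e
  proof -
    define Q where "Q U \<longleftrightarrow> open U \<and> (AE s in lebesgue. s \<in> U \<longrightarrow> dist (g s) (rlim g s) \<le> 2 * e)"
      for U :: "real set"
    have ex: "\<exists>U. Q U \<and> t \<in> U" if t: "t \<in> I" for t
    proof -
      obtain \<delta> where \<delta>: "\<delta> > 0" "ball t \<delta> \<subseteq> I"
        and R: "\<forall>s. t < s \<and> s < t + \<delta> \<longrightarrow> dist (rlim g s) (rlim g t) \<le> e"
        and L: "\<forall>s. t - \<delta> < s \<and> s < t \<longrightarrow> dist (rlim g s) (llim g t) \<le> e"
        and AE: "AE s in lebesgue. t < s \<and> s < t + \<delta> \<longrightarrow> dist (g s) (rlim g t) \<le> e"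
          "AE s in lebesgue. t - \<delta> < s \<and> s < t \<longrightarrow> dist (g s) (llim g t) \<le> e"
        by (rule GG_local[OF g t e])
      \<comment> \<open>The one-sided estimates say nothing about the centre \<open>t\<close>, which
        is discarded as a null set.\<close>
      have "{t} \<in> null_sets lebesgue" by simp
      from AE_not_in[OF this] have "AE s in lebesgue. s \<noteq> t" by simp
      with AE have "AE s in lebesgue. s \<in> ball t \<delta> \<longrightarrow> dist (g s) (rlim g s) \<le> 2 * e"
      proof eventually_elim
        case (elim s)
        show ?case
        proof
          assume "s \<in> ball t \<delta>"
          with elim(3) consider "t < s" "s < t + \<delta>" | "t - \<delta> < s" "s < t"
            by (fastforce simp: dist_real_def)
          then show "dist (g s) (rlim g s) \<le> 2 * e"
          proof cases
            case 1 then show ?thesis using R elim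
              using dist_triangle2[of "g s" "rlim g s" "rlim g t"] by force
          next
            case 2 then show ?thesis using L elim
              using dist_triangle2[of "g s" "rlim g s" "llim g t"] by force
          qed
        qed
      qed
      then show ?thesis using \<delta>(1) by (intro exI[of _ "ball t \<delta>"]) (auto simp: Q_def)
    qed
    \<comment> \<open>Exceptional null sets may only be united countably often, hence the passage to
      a countable subfamily.\<close>
    obtain \<F> where F: "\<F> \<subseteq> Collect Q" "countable \<F>" "\<Union>\<F> = \<Union>(Collect Q)"
      using Lindelof[of "Collect Q"] by (auto simp: Q_def)
    have "AE s in lebesgue. \<forall>U\<in>\<F>. s \<in> U \<longrightarrow> dist (g s) (rlim g s) \<le> 2 * e"
      using F by (subst AE_ball_countable) (auto simp: Q_def)
    then show ?thesis
      by eventually_elim (use ex F(3) in blast)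
  qed
  have "AE s in lebesgue. \<forall>n. s \<in> I \<longrightarrow> dist (g s) (rlim g s) \<le> 2 * inverse (of_nat (Suc n))"
    unfolding AE_all_countable by (intro allI *) simp
  then show ?thesis
  proof eventually_elim
    case (elim s)
    show ?case
    proof
      assume "s \<in> I"
      with elim have le: "dist (g s) (rlim g s) \<le> 2 * inverse (of_nat (Suc n))" for n by blast
      have "(\<lambda>n. 2 * inverse (of_nat (Suc n))) \<longlonglongrightarrow> 2 * (0::real)"
        by (intro tendsto_intros LIMSEQ_inverse_real_of_nat)
      from LIMSEQ_le_const[OF this] le have "dist (g s) (rlim g s) \<le> 2 * 0" by blast
      then show "g s = rlim g s" by simp
    qed
  qed
qed

subsection \<open>Derivatives\<close>

text \<open>The difference quotients determine the right limits of the derivative at every point of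
  \<open>I\<close>, and by \<open>GG_ae_rlim\<close> these determine its class.\<close>

lemma has_GG_deriv_unique:
  assumes I: "open I" and "has_GG_deriv I g h" "has_GG_deriv I g' h'" "ae_eq I g g'"
  shows "ae_eq I h h'"
proof -
  have hG: "h \<in> GG I" "h' \<in> GG I" using assms by (auto simp: has_GG_deriv_def)
  have eq: "rlim h t = rlim h' t" if t: "t \<in> I" for t
  proof -
    have "((\<lambda>s. (g' s - rlim g' t) / of_real (s - t)) \<longlongrightarrow> rlim h' t) (ess_right t)"
      using assms t by (auto simp: has_GG_deriv_def)
    moreover have "\<forall>\<^sub>F s in ess_right t. (g' s - rlim g' t) / of_real (s - t) =
        (g s - rlim g t) / of_real (s - t)"
      using ae_eq_eventually(1)[OF I t assms(4)] ae_eq_rlim[OF I t assms(4)]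
      by (auto elim: eventually_mono)
    ultimately have "((\<lambda>s. (g s - rlim g t) / of_real (s - t)) \<longlongrightarrow> rlim h' t) (ess_right t)"
      by (rule Lim_transform_eventually)
    moreover have "((\<lambda>s. (g s - rlim g t) / of_real (s - t)) \<longlongrightarrow> rlim h t) (ess_right t)"
      using assms t by (auto simp: has_GG_deriv_def)
    ultimately show ?thesis using tendsto_unique ess_right_neq_bot by blast
  qed
  show ?thesis unfolding ae_eq_def
    using GG_ae_rlim[OF I hG(1)] GG_ae_rlim[OF I hG(2)]
    by eventually_elim (use eq in auto)
qed

lemma GG_deriv_seq_unique:
  assumes "open I" "GG_deriv_seq I g d" "GG_deriv_seq I g' d'" "ae_eq I g g'"
  shows "ae_eq I (d k) (d' k)"
proof (induction k)
  case 0 then show ?case using assms by (auto simp: GG_deriv_seq_def)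
next
  case (Suc k)
  show ?case
    by (rule has_GG_deriv_unique[OF assms(1) _ _ Suc]) (use assms in \<open>auto simp: GG_deriv_seq_def\<close>)
qed

lemma GG_deriv_seq_GG_deriv:
  assumes "g \<in> GG_inf I"
  shows "GG_deriv_seq I g (\<lambda>k. GG_deriv I k g)"
proof -
  have "\<exists>d. GG_deriv_seq I g d" using assms by (simp add: GG_inf_def)
  from someI_ex[OF this] show ?thesis by (simp add: GG_deriv_def)
qed

lemma GG_deriv_seq_GG: "GG_deriv_seq I g d \<Longrightarrow> g \<in> GG I \<Longrightarrow> d k \<in> GG I"
  unfolding GG_deriv_seq_def has_GG_deriv_def by (cases k) auto

lemma GG_inf_GG: "g \<in> GG_inf I \<Longrightarrow> g \<in> GG I"
  by (simp add: GG_inf_def)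

lemma GG_infI: "g \<in> GG I \<Longrightarrow> GG_deriv_seq I g d \<Longrightarrow> g \<in> GG_inf I"
  by (auto simp: GG_inf_def)

text \<open>Lets any explicitly given derivative sequence stand in for the one selected by
  \<open>SOME\<close> in \<open>GG_deriv\<close>.\<close>

lemma GG_deriv_ae_eq:
  assumes "open I" "g \<in> GG I" "GG_deriv_seq I g d"
  shows "ae_eq I (GG_deriv I k g) (d k)"
  using GG_deriv_seq_unique[OF assms(1) GG_deriv_seq_GG_deriv[OF GG_infI] assms(3)] assms by simp

lemma jump_GG_deriv:
  assumes "open I" "g \<in> GG I" "GG_deriv_seq I g d" "t \<in> I"
  shows "jump t (GG_deriv I k g) = jump t (d k)"
  using ae_eq_jump GG_deriv_ae_eq assms by metis

section \<open>Linear combinations of regulated functions and of derivative sequences\<close>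

lemma GG_lincomb:
  assumes I: "open I" and g: "g \<in> GG I" and h: "h \<in> GG I"
  shows "(\<lambda>t. \<alpha> * g t + \<beta> * h t) \<in> GG I"
    and "t \<in> I \<Longrightarrow> rlim (\<lambda>t. \<alpha> * g t + \<beta> * h t) t = \<alpha> * rlim g t + \<beta> * rlim h t"
    and "t \<in> I \<Longrightarrow> llim (\<lambda>t. \<alpha> * g t + \<beta> * h t) t = \<alpha> * llim g t + \<beta> * llim h t"
proof -
  have R: "((\<lambda>t. \<alpha> * g t + \<beta> * h t) \<longlongrightarrow> \<alpha> * rlim g t + \<beta> * rlim h t) (ess_right t)"
    and L: "((\<lambda>t. \<alpha> * g t + \<beta> * h t) \<longlongrightarrow> \<alpha> * llim g t + \<beta> * llim h t) (ess_left t)"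
    if "t \<in> I" for t
    using that I g h by (intro tendsto_intros; simp add: GG_tendsto)+
  show "t \<in> I \<Longrightarrow> rlim (\<lambda>t. \<alpha> * g t + \<beta> * h t) t = \<alpha> * rlim g t + \<beta> * rlim h t"
    using R rlim_eqI by blast
  show "t \<in> I \<Longrightarrow> llim (\<lambda>t. \<alpha> * g t + \<beta> * h t) t = \<alpha> * llim g t + \<beta> * llim h t"
    using L llim_eqI by blast
  have m: "g \<in> borel_measurable (lebesgue_on I)" "h \<in> borel_measurable (lebesgue_on I)"
    using g h by (auto simp: GG_iff[OF I])
  obtain A B where "AE t in lebesgue. t \<in> I \<longrightarrow> cmod (g t) \<le> A"
    "AE t in lebesgue. t \<in> I \<longrightarrow> cmod (h t) \<le> B"
    using g h unfolding GG_iff[OF I] by blast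
  then have "AE t in lebesgue. t \<in> I \<longrightarrow> cmod (\<alpha> * g t + \<beta> * h t) \<le> cmod \<alpha> * A + cmod \<beta> * B"
    by eventually_elim
      (auto intro!: norm_triangle_le add_mono mult_left_mono simp: norm_mult)
  then show "(\<lambda>t. \<alpha> * g t + \<beta> * h t) \<in> GG I"
    unfolding GG_iff[OF I] using m R L rlim_eqI[OF R] llim_eqI[OF L] by auto
qed

lemma GG_deriv_seq_lincomb:
  assumes I: "open I" and "g \<in> GG I" "h \<in> GG I" and d: "GG_deriv_seq I g d" "GG_deriv_seq I h e"
  shows "GG_deriv_seq I (\<lambda>t. \<alpha> * g t + \<beta> * h t) (\<lambda>k t. \<alpha> * d k t + \<beta> * e k t)"
  unfolding GG_deriv_seq_def has_GG_deriv_def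
proof (intro conjI allI ballI)
  have G: "d k \<in> GG I" "e k \<in> GG I" for k
    using GG_deriv_seq_GG assms by auto
  note lc = GG_lincomb[OF I G]
  show "(\<lambda>t. \<alpha> * d 0 t + \<beta> * e 0 t) = (\<lambda>t. \<alpha> * g t + \<beta> * h t)"
    using d by (auto simp: GG_deriv_seq_def)
  fix k
  show "(\<lambda>t. \<alpha> * d (Suc k) t + \<beta> * e (Suc k) t) \<in> GG I" by (rule lc)
  fix t assume t: "t \<in> I"
  have "((\<lambda>s. \<alpha> * ((d k s - rlim (d k) t) / of_real (s - t)) + \<beta> * ((e k s - rlim (e k) t) / of_real (s - t)))
      \<longlongrightarrow> \<alpha> * rlim (d (Suc k)) t + \<beta> * rlim (e (Suc k)) t) (ess_right t)"
    using d t by (intro tendsto_intros) (auto simp: GG_deriv_seq_def has_GG_deriv_def)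
  then show "((\<lambda>s. (\<alpha> * d k s + \<beta> * e k s - rlim (\<lambda>t. \<alpha> * d k t + \<beta> * e k t) t) / of_real (s - t))
      \<longlongrightarrow> rlim (\<lambda>t. \<alpha> * d (Suc k) t + \<beta> * e (Suc k) t) t) (ess_right t)"
    unfolding lc(2)[OF t] by (simp add: algebra_simps add_divide_distrib diff_divide_distrib)
  have "((\<lambda>s. \<alpha> * ((d k s - llim (d k) t) / of_real (s - t)) + \<beta> * ((e k s - llim (e k) t) / of_real (s - t)))
      \<longlongrightarrow> \<alpha> * llim (d (Suc k)) t + \<beta> * llim (e (Suc k)) t) (ess_left t)"
    using d t by (intro tendsto_intros) (auto simp: GG_deriv_seq_def has_GG_deriv_def)
  then show "((\<lambda>s. (\<alpha> * d k s + \<beta> * e k s - llim (\<lambda>t. \<alpha> * d k t + \<beta> * e k t) t) / of_real (s - t))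
      \<longlongrightarrow> llim (\<lambda>t. \<alpha> * d (Suc k) t + \<beta> * e (Suc k) t) t) (ess_left t)"
    unfolding lc(3)[OF t] by (simp add: algebra_simps add_divide_distrib diff_divide_distrib)
qed

subsection \<open>Supports\<close>

lemma GG_supp_subset: "GG_supp I g \<subseteq> I"
  unfolding GG_supp_def using closure_of_subset_topspace by fastforce

lemma closedin_GG_supp: "closedin (top_of_set I) (GG_supp I g)"
  unfolding GG_supp_def by simp

lemma GG_suppI: "t \<in> I \<Longrightarrow> llim g t \<noteq> 0 \<or> rlim g t \<noteq> 0 \<Longrightarrow> t \<in> GG_supp I g"
  unfolding GG_supp_def by (rule subsetD[OF closure_of_subset]) auto

lemma GG_supp_subsetI:
  assumes "closedin (top_of_set I) K" "\<And>t. t \<in> I - K \<Longrightarrow> llim g t = 0 \<and> rlim g t = 0"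
  shows "GG_supp I g \<subseteq> K"
  unfolding GG_supp_def using assms by (intro closure_of_minimal) auto

lemma GG_supp_eq_0_ae:
  assumes "open I" "g \<in> GG I"
  shows "AE t in lebesgue. t \<in> I - GG_supp I g \<longrightarrow> g t = 0"
  using GG_ae_rlim[OF assms] by eventually_elim (auto dest: GG_suppI)

lemma open_minus_GG_supp:
  assumes "open I" shows "open (I - GG_supp I g)"
proof -
  have "openin (top_of_set I) (I - GG_supp I g)"
    using closedin_GG_supp by (auto simp: closedin_def)
  then show ?thesis using assms openin_open_eq by blast
qed

lemma GG_supp_subset_of_ae:
  assumes "open I" "closed K" "AE t in lebesgue. t \<in> I - K \<longrightarrow> g t = 0"
  shows "GG_supp I g \<subseteq> K"
proof -
  have "llim g t = 0 \<and> rlim g t = 0" if "t \<in> I - K" for t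
  proof -
    have o: "open (I - K)" using assms by auto
    have "ae_eq (I - K) g (\<lambda>_. 0)" using assms by (auto simp: ae_eq_def)
    from ae_eq_rlim[OF o that this] ae_eq_llim[OF o that this]
    show ?thesis by simp
  qed
  then have "GG_supp I g \<subseteq> I \<inter> K"
    using assms(2) by (intro GG_supp_subsetI) (auto simp: closedin_closed)
  then show ?thesis by blast
qed

text \<open>Any compact \<open>K\<close> in \<open>I\<close> off which \<open>g\<close> vanishes
  will do: it contains the support, which is closed in \<open>I\<close> and therefore compact. The
  exact support never has to be computed.\<close>

lemma RR_I:
  assumes "open I" "g \<in> GG I" "GG_deriv_seq I g d" and K: "compact K" "K \<subseteq> I"
    and "AE t in lebesgue. t \<in> I - K \<longrightarrow> g t = 0"
  shows "g \<in> RR I"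
proof -
  have "GG_supp I g \<subseteq> K"
    using assms compact_imp_closed by (intro GG_supp_subset_of_ae) auto
  then have "compact (GG_supp I g)"
    using closedin_compact closedin_subset_trans closedin_GG_supp K by metis
  then show ?thesis using assms GG_infI by (auto simp: RR_def)
qed

lemma RR_GG: "g \<in> RR I \<Longrightarrow> g \<in> GG I"
  by (simp add: RR_def GG_inf_def)

lemma RR_GG_deriv_seq: "g \<in> RR I \<Longrightarrow> GG_deriv_seq I g (\<lambda>k. GG_deriv I k g)"
  by (simp add: RR_def GG_deriv_seq_GG_deriv)

lemma RR_lincomb:
  assumes I: "open I" and g: "g \<in> RR I" and h: "h \<in> RR I"
  shows "(\<lambda>t. \<alpha> * g t + \<beta> * h t) \<in> RR I"
proof (rule RR_I[OF I])
  show "(\<lambda>t. \<alpha> * g t + \<beta> * h t) \<in> GG I" by (intro GG_lincomb I RR_GG g h)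
  show "GG_deriv_seq I (\<lambda>t. \<alpha> * g t + \<beta> * h t)
      (\<lambda>k t. \<alpha> * GG_deriv I k g t + \<beta> * GG_deriv I k h t)"
    using I g h by (intro GG_deriv_seq_lincomb RR_GG RR_GG_deriv_seq)
  show "compact (GG_supp I g \<union> GG_supp I h)" using g h by (auto simp: RR_def)
  show "GG_supp I g \<union> GG_supp I h \<subseteq> I" using GG_supp_subset by blast
  show "AE t in lebesgue. t \<in> I - (GG_supp I g \<union> GG_supp I h) \<longrightarrow> \<alpha> * g t + \<beta> * h t = 0"
    using GG_supp_eq_0_ae[OF I RR_GG[OF g]] GG_supp_eq_0_ae[OF I RR_GG[OF h]]
    by eventually_elim auto
qed

lemma GG_const_0: "open I \<Longrightarrow> (\<lambda>_. 0) \<in> GG I"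
  by (auto simp: GG_iff intro!: exI[of _ 0])

lemma GG_deriv_seq_0: "open I \<Longrightarrow> GG_deriv_seq I (\<lambda>_. 0) (\<lambda>_ _. 0)"
  by (auto simp: GG_deriv_seq_def has_GG_deriv_def GG_const_0)

lemma RR_0: "open I \<Longrightarrow> (\<lambda>_. 0) \<in> RR I"
  by (rule RR_I[OF _ GG_const_0 GG_deriv_seq_0, of _ "{}"]) auto

lemma jump_lincomb:
  assumes I: "open I" and "g \<in> GG I" "h \<in> GG I" and "t \<in> I"
  shows "jump t (\<lambda>t. \<alpha> * g t + \<beta> * h t) = \<alpha> * jump t g + \<beta> * jump t h"
  using GG_lincomb[OF assms(1-3)] assms(4) by (simp add: jump_def algebra_simps)

lemma GG_deriv_lincomb_jump:
  assumes I: "open I" and g: "g \<in> GG_inf I" and h: "h \<in> GG_inf I" and t: "t \<in> I"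
  shows "jump t (GG_deriv I k (\<lambda>t. \<alpha> * g t + \<beta> * h t)) =
    \<alpha> * jump t (GG_deriv I k g) + \<beta> * jump t (GG_deriv I k h)"
proof -
  note G = GG_inf_GG[OF g] GG_inf_GG[OF h] and d = GG_deriv_seq_GG_deriv[OF g] GG_deriv_seq_GG_deriv[OF h]
  show ?thesis
    unfolding jump_GG_deriv[OF I GG_lincomb(1)[OF I G] GG_deriv_seq_lincomb[OF I G d] t]
    using I t GG_deriv_seq_GG[OF d(1) G(1)] GG_deriv_seq_GG[OF d(2) G(2)] by (intro jump_lincomb)
qed

lemma GG_inf_lincomb:
  assumes I: "open I" and g: "g \<in> GG_inf I" and h: "h \<in> GG_inf I"
  shows "(\<lambda>t. \<alpha> * g t + \<beta> * h t) \<in> GG_inf I"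
  by (rule GG_infI[OF GG_lincomb(1) GG_deriv_seq_lincomb[OF _ _ _
        GG_deriv_seq_GG_deriv[OF g] GG_deriv_seq_GG_deriv[OF h]]])
    (intro I g h GG_inf_GG)+

lemma GG_inf_0: "open I \<Longrightarrow> (\<lambda>_. 0) \<in> GG_inf I"
  using GG_infI GG_const_0 GG_deriv_seq_0 by blast

text \<open>Membership and the jump formula share one induction, since the formula for one more
  summand presupposes that the remaining sum lies in \<open>GG_inf I\<close>.\<close>

lemma GG_inf_sum:
  assumes I: "open I" and "finite S" "\<And>x. x \<in> S \<Longrightarrow> h x \<in> GG_inf I"
  shows "(\<lambda>t. \<Sum>x\<in>S. \<alpha> x * h x t) \<in> GG_inf I \<and>
    (\<forall>t\<in>I. jump t (GG_deriv I k (\<lambda>t. \<Sum>x\<in>S. \<alpha> x * h x t)) = (\<Sum>x\<in>S. \<alpha> x * jump t (GG_deriv I k (h x))))"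
  using assms(2,3)
proof (induction S rule: finite_induct)
  case empty
  then show ?case
    using jump_GG_deriv[OF I GG_const_0[OF I] GG_deriv_seq_0[OF I]]
    by (auto simp: GG_inf_0 I jump_def)
next
  case (insert x S)
  then have *: "h x \<in> GG_inf I" "(\<lambda>t. \<Sum>x\<in>S. \<alpha> x * h x t) \<in> GG_inf I" by auto
  show ?case
    using GG_inf_lincomb[OF I *, of "\<alpha> x" 1] GG_deriv_lincomb_jump[OF I *, of _ k "\<alpha> x" 1] insert
    by simp
qed

lemma RR_sum:
  assumes I: "open I" and "finite S" "\<And>x. x \<in> S \<Longrightarrow> h x \<in> RR I"
  shows "(\<lambda>t. \<Sum>x\<in>S. \<alpha> x * h x t) \<in> RR I"
  using assms(2,3)
proof (induction S rule: finite_induct)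
  case empty
  show ?case using RR_0[OF I] by simp
next
  case (insert x S)
  then show ?case using RR_lincomb[OF I, of "h x" "\<lambda>t. \<Sum>x\<in>S. \<alpha> x * h x t" "\<alpha> x" 1] by simp
qed

section \<open>Localisation to smaller open sets\<close>

lemma GG_subset:
  assumes I: "open I" and J: "open J" "J \<subseteq> I" and g: "g \<in> GG I"
  shows "g \<in> GG J"
proof -
  obtain B where "AE t in lebesgue. t \<in> I \<longrightarrow> cmod (g t) \<le> B"
    using g unfolding GG_iff[OF I] by blast
  then have "AE t in lebesgue. t \<in> J \<longrightarrow> cmod (g t) \<le> B"
    by eventually_elim (use J in auto)
  moreover have "g \<in> borel_measurable (lebesgue_on J)"
    using g J(2) unfolding GG_iff[OF I] by (blast intro: measurable_restrict_mono)
  ultimately show ?thesis using g J(2) unfolding GG_iff[OF I] GG_iff[OF J(1)] by blast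
qed

lemma GG_deriv_seq_subset:
  "open I \<Longrightarrow> open J \<Longrightarrow> J \<subseteq> I \<Longrightarrow> GG_deriv_seq I g d \<Longrightarrow> GG_deriv_seq J g d"
  unfolding GG_deriv_seq_def has_GG_deriv_def by (auto dest: GG_subset[of I J])

text \<open>Uniqueness of derivatives, applied on the smaller open set \<open>I - GG_supp I g\<close>.\<close>

lemma deriv_eq_0_off_supp:
  assumes I: "open I" and g: "g \<in> GG I" "GG_deriv_seq I g d" and t: "t \<in> I - GG_supp I g"
  shows "rlim (d k) t = 0" "llim (d k) t = 0"
proof -
  let ?J = "I - GG_supp I g"
  have J: "open ?J" using open_minus_GG_supp I by blast
  have "ae_eq ?J g (\<lambda>_. 0)" unfolding ae_eq_def using GG_supp_eq_0_ae[OF I g(1)] .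
  then have "ae_eq ?J (d k) (\<lambda>_. 0)"
    using GG_deriv_seq_unique[OF J GG_deriv_seq_subset[OF I J _ g(2)] GG_deriv_seq_0[OF J]] by auto
  then show "rlim (d k) t = 0" "llim (d k) t = 0"
    using ae_eq_rlim[OF J t] ae_eq_llim[OF J t] by auto
qed

subsection \<open>Multiplication with indicators of half-lines\<close>

definition cut :: "real \<Rightarrow> (real \<Rightarrow> complex) \<Rightarrow> real \<Rightarrow> complex" where
  "cut u g s = (if u < s then g s else 0)"

lemma eventually_ess_rightI: "u < v \<Longrightarrow> (\<And>s. u < s \<Longrightarrow> s < v \<Longrightarrow> P s) \<Longrightarrow> eventually P (ess_right u)"
  unfolding eventually_ess_right by (intro exI[of _ "v - u"]) auto

lemma eventually_ess_leftI: "v < u \<Longrightarrow> (\<And>s. v < s \<Longrightarrow> s < u \<Longrightarrow> P s) \<Longrightarrow> eventually P (ess_left u)"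
  unfolding eventually_ess_left by (intro exI[of _ "u - v"]) auto

lemma cut_eventually_right:
  "u \<le> t \<Longrightarrow> \<forall>\<^sub>F s in ess_right t. cut u g s = g s"
  "t < u \<Longrightarrow> \<forall>\<^sub>F s in ess_right t. cut u g s = 0"
  by (rule eventually_ess_rightI[of t "t + 1"]; simp add: cut_def)
    (rule eventually_ess_rightI[of t u]; simp add: cut_def)

lemma cut_eventually_left:
  "u < t \<Longrightarrow> \<forall>\<^sub>F s in ess_left t. cut u g s = g s"
  "t \<le> u \<Longrightarrow> \<forall>\<^sub>F s in ess_left t. cut u g s = 0"
  by (rule eventually_ess_leftI[of u t]; simp add: cut_def)
    (rule eventually_ess_leftI[of "t - 1" t]; simp add: cut_def)

text \<open>At \<open>t = u\<close> the right limit survives while the left one becomes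
  \<open>0\<close>; hence the non-strict comparison here and the strict one in
  \<open>llim_cut\<close>.\<close>

lemma rlim_cut: "rlim (cut u g) t = (if u \<le> t then rlim g t else 0)"
  using rlim_cong[OF cut_eventually_right(1)] rlim_cong[OF cut_eventually_right(2)] by auto

lemma llim_cut: "llim (cut u g) t = (if u < t then llim g t else 0)"
  using llim_cong[OF cut_eventually_left(1)] llim_cong[OF cut_eventually_left(2)] by auto

lemma jump_cut_isCont:
  assumes "isCont g t"
  shows "jump t (cut u g) = (if t = u then g t else 0)"
  using isCont_rlim_llim[OF assms] by (auto simp: jump_def rlim_cut llim_cut)

lemma cut_GG:
  assumes I: "open I" and g: "g \<in> GG I"
  shows "cut u g \<in> GG I"
  unfolding GG_iff[OF I]
proof (intro conjI ballI)
  have m: "g \<in> borel_measurable (lebesgue_on I)" using g by (simp add: GG_iff[OF I])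
  have "{x \<in> I. u < x} = I \<inter> {u<..}" by auto
  then have "{x \<in> space (lebesgue_on I). u < x} \<in> sets (lebesgue_on I)"
    using I by (simp add: sets_restrict_space_iff)
  then show "cut u g \<in> borel_measurable (lebesgue_on I)"
    unfolding cut_def[abs_def] using m by (intro measurable_If) auto
  obtain B where "AE t in lebesgue. t \<in> I \<longrightarrow> cmod (g t) \<le> B"
    using g unfolding GG_iff[OF I] by blast
  then have "AE t in lebesgue. t \<in> I \<longrightarrow> cmod (cut u g t) \<le> max B 0"
    by eventually_elim (auto simp: cut_def)
  then show "\<exists>B. AE t in lebesgue. t \<in> I \<longrightarrow> cmod (cut u g t) \<le> B" by blast
  fix t assume t: "t \<in> I"
  show "(cut u g \<longlongrightarrow> rlim (cut u g) t) (ess_right t)"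
  proof (cases "u \<le> t")
    case True
    then show ?thesis
      using GG_tendsto(1)[OF I g t] tendsto_cong[OF cut_eventually_right(1)[OF True, of g]]
      by (simp add: rlim_cut)
  next
    case False
    then show ?thesis
      using tendsto_cong[OF cut_eventually_right(2)[of t u g]] by (simp add: rlim_cut)
  qed
  show "(cut u g \<longlongrightarrow> llim (cut u g) t) (ess_left t)"
  proof (cases "u < t")
    case True
    then show ?thesis
      using GG_tendsto(2)[OF I g t] tendsto_cong[OF cut_eventually_left(1)[OF True, of g]]
      by (simp add: llim_cut)
  next
    case False
    then show ?thesis
      using tendsto_cong[OF cut_eventually_left(2)[of t u g]] by (simp add: llim_cut)
  qed
qed

text \<open>On either side of any point, the cut function agrees near that point with
  \<open>g\<close> or with \<open>0\<close>. The difference quotients use the one-sided limits as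
  base values, so nothing has to match at \<open>u\<close>, even when the cut creates a jump
  there.\<close>

lemma cut_has_GG_deriv:
  assumes I: "open I" and h: "has_GG_deriv I g h"
  shows "has_GG_deriv I (cut u g) (cut u h)"
  unfolding has_GG_deriv_def
proof (intro conjI ballI)
  show "cut u h \<in> GG I" using h cut_GG[OF I] by (simp add: has_GG_deriv_def)
  fix t assume t: "t \<in> I"
  note R = cut_eventually_right[where g = g] and L = cut_eventually_left[where g = g]
  show "((\<lambda>s. (cut u g s - rlim (cut u g) t) / of_real (s - t)) \<longlongrightarrow> rlim (cut u h) t) (ess_right t)"
  proof (cases "u \<le> t")
    case True
    have "((\<lambda>s. (g s - rlim g t) / of_real (s - t)) \<longlongrightarrow> rlim h t) (ess_right t)"
      using h t by (simp add: has_GG_deriv_def)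
    moreover have "\<forall>\<^sub>F s in ess_right t. (g s - rlim g t) / of_real (s - t) =
        (cut u g s - rlim (cut u g) t) / of_real (s - t)"
      using R(1)[OF True] by eventually_elim (simp add: True rlim_cut)
    ultimately have "((\<lambda>s. (cut u g s - rlim (cut u g) t) / of_real (s - t)) \<longlongrightarrow> rlim h t) (ess_right t)"
      by (rule Lim_transform_eventually)
    then show ?thesis using True by (simp add: rlim_cut)
  next
    case False
    then have "\<forall>\<^sub>F s in ess_right t. 0 = (cut u g s - rlim (cut u g) t) / of_real (s - t)"
      using R(2)[of t u] by (auto simp: rlim_cut elim: eventually_mono)
    from Lim_transform_eventually[OF tendsto_const this] show ?thesis using False by (simp add: rlim_cut)
  qed
  show "((\<lambda>s. (cut u g s - llim (cut u g) t) / of_real (s - t)) \<longlongrightarrow> llim (cut u h) t) (ess_left t)"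
  proof (cases "u < t")
    case True
    have "((\<lambda>s. (g s - llim g t) / of_real (s - t)) \<longlongrightarrow> llim h t) (ess_left t)"
      using h t by (simp add: has_GG_deriv_def)
    moreover have "\<forall>\<^sub>F s in ess_left t. (g s - llim g t) / of_real (s - t) =
        (cut u g s - llim (cut u g) t) / of_real (s - t)"
      using L(1)[OF True] by eventually_elim (simp add: True llim_cut)
    ultimately have "((\<lambda>s. (cut u g s - llim (cut u g) t) / of_real (s - t)) \<longlongrightarrow> llim h t) (ess_left t)"
      by (rule Lim_transform_eventually)
    then show ?thesis using True by (simp add: llim_cut)
  next
    case False
    then have "\<forall>\<^sub>F s in ess_left t. 0 = (cut u g s - llim (cut u g) t) / of_real (s - t)"
      using L(2)[of t u] by (auto simp: llim_cut elim: eventually_mono)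
    from Lim_transform_eventually[OF tendsto_const this] show ?thesis using False by (simp add: llim_cut)
  qed
qed

lemma cut_GG_deriv_seq:
  "open I \<Longrightarrow> GG_deriv_seq I g d \<Longrightarrow> GG_deriv_seq I (cut u g) (\<lambda>k. cut u (d k))"
  by (simp add: GG_deriv_seq_def cut_has_GG_deriv)

lemma cut_RR:
  assumes I: "open I" and g: "g \<in> RR I"
  shows "cut u g \<in> RR I"
proof (rule RR_I[OF I])
  show "cut u g \<in> GG I" using cut_GG[OF I RR_GG[OF g]] .
  show "GG_deriv_seq I (cut u g) (\<lambda>k. cut u (GG_deriv I k g))"
    using cut_GG_deriv_seq[OF I RR_GG_deriv_seq[OF g]] .
  show "compact (GG_supp I g)" "GG_supp I g \<subseteq> I" using g GG_supp_subset by (auto simp: RR_def)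
  show "AE t in lebesgue. t \<in> I - GG_supp I g \<longrightarrow> cut u g t = 0"
    using GG_supp_eq_0_ae[OF I RR_GG[OF g]] by eventually_elim (auto simp: cut_def)
qed

subsection \<open>Smooth functions and functions without jumps\<close>

text \<open>Links the quotients in \<open>has_GG_deriv\<close> to the classical derivative: for
  \<open>s \<noteq> t\<close> the two remainders have the same norm.\<close>

lemma has_vector_derivative_at_iff_quotient:
  fixes f :: "real \<Rightarrow> complex"
  shows "(f has_vector_derivative D) (at t) \<longleftrightarrow> ((\<lambda>s. (f s - f t) / of_real (s - t)) \<longlongrightarrow> D) (at t)"
proof -
  have "(f has_vector_derivative D) (at t) \<longleftrightarrow>
      ((\<lambda>s. (1 / norm (s - t)) *\<^sub>R (f s - (f t + (s - t) *\<^sub>R D))) \<longlongrightarrow> 0) (at t)"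
    unfolding has_vector_derivative_def has_derivative_within
    by (simp add: bounded_linear_scaleR_left)
  also have "\<dots> \<longleftrightarrow> ((\<lambda>s. norm ((1 / norm (s - t)) *\<^sub>R (f s - (f t + (s - t) *\<^sub>R D)))) \<longlongrightarrow> 0) (at t)"
    by (rule tendsto_norm_zero_iff[symmetric])
  also have "\<dots> \<longleftrightarrow> ((\<lambda>s. norm ((f s - f t) / of_real (s - t) - D)) \<longlongrightarrow> 0) (at t)"
  proof (rule tendsto_cong)
    have "norm ((1 / norm (s - t)) *\<^sub>R (f s - (f t + (s - t) *\<^sub>R D))) =
        norm ((f s - f t) / of_real (s - t) - D)" if "s \<noteq> t" for s
    proof -
      have *: "(f s - f t) / of_real (s - t) - D = (f s - (f t + (s - t) *\<^sub>R D)) / of_real (s - t)"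
        using that by (simp add: field_simps scaleR_conv_of_real)
      show ?thesis unfolding * norm_divide norm_scaleR norm_of_real by simp
    qed
    then show "\<forall>\<^sub>F s in at t. norm ((1 / norm (s - t)) *\<^sub>R (f s - (f t + (s - t) *\<^sub>R D))) =
        norm ((f s - f t) / of_real (s - t) - D)"
      by (auto simp: eventually_at_filter)
  qed
  also have "\<dots> \<longleftrightarrow> ((\<lambda>s. (f s - f t) / of_real (s - t)) \<longlongrightarrow> D) (at t)"
    unfolding tendsto_norm_zero_iff by (rule LIM_zero_iff)
  finally show ?thesis .
qed

section \<open>Compactly supported smooth functions as test functions\<close>

context
  fixes I K :: "real set" and d :: "nat \<Rightarrow> real \<Rightarrow> complex"
  assumes I: "open I"
    and d: "\<And>k t. t \<in> I \<Longrightarrow> (d k has_vector_derivative d (Suc k) t) (at t)"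
    and K: "compact K" "K \<subseteq> I" "\<And>t. t \<in> I - K \<Longrightarrow> d 0 t = 0"
begin

lemma smooth_isCont: "t \<in> I \<Longrightarrow> isCont (d k) t"
  using has_vector_derivative_continuous[OF d] by blast

text \<open>The set \<open>I - K\<close> is open, so the derivative of the zero function is what
  remains there. With continuity on \<open>K\<close> this yields global bounds.\<close>

lemma smooth_eq_0_off: "t \<in> I - K \<Longrightarrow> d k t = 0"
proof (induction k arbitrary: t)
  case 0
  then show ?case using K by blast
next
  case (Suc k)
  have o: "open (I - K)" using I compact_imp_closed[OF K(1)] by blast
  have "((\<lambda>_. 0) has_vector_derivative d (Suc k) t) (at t)"
    using Suc by (intro has_vector_derivative_transform_within_open[OF d o]) auto
  then show ?case using vector_derivative_unique_at has_vector_derivative_const by blast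
qed

lemma smooth_bounded: "\<exists>B. \<forall>t\<in>I. cmod (d k t) \<le> B"
proof -
  have "continuous_on K (d k)"
    using smooth_isCont K by (auto intro: continuous_at_imp_continuous_on)
  then have "bounded (d k ` K)" using K compact_continuous_image compact_imp_bounded by blast
  then obtain B where B: "\<And>t. t \<in> K \<Longrightarrow> cmod (d k t) \<le> B" by (auto simp: bounded_iff)
  have "cmod (d k t) \<le> max B 0" if "t \<in> I" for t
    using smooth_eq_0_off[of t k] B[of t] that by (cases "t \<in> K") auto
  then show ?thesis by blast
qed

lemma smooth_GG: "d k \<in> GG I"
  unfolding GG_iff[OF I]
proof (intro conjI ballI)
  have "continuous_on I (d k)"
    using smooth_isCont by (auto intro: continuous_at_imp_continuous_on)
  then show "d k \<in> borel_measurable (lebesgue_on I)"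
    using I by (intro continuous_imp_measurable_on_sets_lebesgue) auto
  show "\<exists>B. AE t in lebesgue. t \<in> I \<longrightarrow> cmod (d k t) \<le> B" using smooth_bounded[of k] by auto
  fix t assume "t \<in> I"
  from smooth_isCont[OF this, of k] isCont_rlim_llim[OF smooth_isCont[OF this], of k]
  show "(d k \<longlongrightarrow> rlim (d k) t) (ess_right t)" "(d k \<longlongrightarrow> llim (d k) t) (ess_left t)"
    by (auto simp: isCont_def intro: tendsto_mono[OF ess_right_le_at] tendsto_mono[OF ess_left_le_at])
qed

lemma smooth_GG_deriv_seq: "GG_deriv_seq I (d 0) d"
  unfolding GG_deriv_seq_def has_GG_deriv_def
proof (intro conjI allI ballI smooth_GG refl)
  fix k t assume t: "t \<in> I"
  have "((\<lambda>s. (d k s - d k t) / of_real (s - t)) \<longlongrightarrow> d (Suc k) t) (at t)"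
    using d[OF t] has_vector_derivative_at_iff_quotient by blast
  then show "((\<lambda>s. (d k s - rlim (d k) t) / of_real (s - t)) \<longlongrightarrow> rlim (d (Suc k)) t) (ess_right t)"
    "((\<lambda>s. (d k s - llim (d k) t) / of_real (s - t)) \<longlongrightarrow> llim (d (Suc k)) t) (ess_left t)"
    using isCont_rlim_llim[OF smooth_isCont[OF t]]
    by (auto intro: tendsto_mono[OF ess_right_le_at] tendsto_mono[OF ess_left_le_at])
qed

lemma smooth_RR: "d 0 \<in> RR I"
  using K(3) by (intro RR_I[OF I smooth_GG smooth_GG_deriv_seq K(1,2)]) auto

lemma smooth_DD: "d 0 \<in> DD I"
  unfolding DD_def using d K by blast

end

section \<open>Jump-free functions are smooth almost everywhere up to representatives\<close>

lemma tendsto_at_of_ess: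
  fixes q :: "real \<Rightarrow> complex"
  assumes R: "(q \<longlongrightarrow> L) (ess_right t)" and L: "(q \<longlongrightarrow> L) (ess_left t)"
    and cont: "eventually (\<lambda>s. isCont q s) (at t)"
  shows "(q \<longlongrightarrow> L) (at t)"
proof -
  obtain \<eta> where \<eta>: "\<eta> > 0" "\<And>s. s \<noteq> t \<Longrightarrow> dist s t < \<eta> \<Longrightarrow> isCont q s"
    using cont unfolding eventually_at by auto
  \<comment> \<open>At a point of continuity, an almost-everywhere estimate on an interval around it
    passes to the value itself. Strictness is lost in the limit, so the estimates are later taken
    with \<open>e / 2\<close>.\<close>
  have near: "dist (q s) L \<le> e"
    if AE: "AE x in lebesgue. u < x \<and> x < v \<longrightarrow> dist (q x) L < e" and s: "u < s" "s < v"
      and c: "isCont q s" for u v s e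
  proof -
    have "AE x in lebesgue. s < x \<and> x < s + (v - s) \<longrightarrow> dist (q x) L \<le> e"
      using AE by eventually_elim (use s in auto)
    then have "\<forall>\<^sub>F x in ess_right s. dist (q x) L \<le> e"
      unfolding eventually_ess_right using s by (intro exI[of _ "v - s"]) auto
    moreover have "(q \<longlongrightarrow> q s) (ess_right s)"
      using c tendsto_mono[OF ess_right_le_at] by (auto simp: isCont_def)
    ultimately show ?thesis
      by (intro tendsto_upperbound[OF tendsto_dist[OF _ tendsto_const] _ ess_right_neq_bot])
  qed
  show ?thesis
  proof (rule tendstoI)
    fix e :: real assume "e > 0"
    then have e: "e / 2 > 0" by simp
    obtain a where a: "a > 0" "AE s in lebesgue. t < s \<and> s < t + a \<longrightarrow> dist (q s) L < e / 2"
      using tendstoD[OF R e] unfolding eventually_ess_right by blast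
    obtain b where b: "b > 0" "AE s in lebesgue. t - b < s \<and> s < t \<longrightarrow> dist (q s) L < e / 2"
      using tendstoD[OF L e] unfolding eventually_ess_left by blast
    have "dist (q s) L < e" if s: "s \<noteq> t" "dist s t < min \<eta> (min a b)" for s
    proof -
      have c: "isCont q s" using \<eta> s by auto
      have "dist (q s) L \<le> e / 2"
      proof (cases "t < s")
        case True
        then show ?thesis using near[OF a(2) _ _ c] s by (auto simp: dist_real_def)
      next
        case False
        then show ?thesis using near[OF b(2) _ _ c] s by (auto simp: dist_real_def)
      qed
      then show ?thesis using \<open>e > 0\<close> by simp
    qed
    then show "\<forall>\<^sub>F s in at t. dist (q s) L < e"
      unfolding eventually_at using \<eta> a b by (intro exI[of _ "min \<eta> (min a b)"]) auto
  qed
qed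

text \<open>Without a jump at \<open>t\<close>, the left and right estimates of
  \<open>GG_local\<close> refer to the same value.\<close>

lemma GG_isCont_rlim:
  assumes g: "open I" "g \<in> GG I" and J: "\<And>s. s \<in> I \<Longrightarrow> jump s g = 0" and t: "t \<in> I"
  shows "isCont (rlim g) t"
  unfolding isCont_def
proof (rule tendstoI)
  fix e :: real assume "e > 0"
  then have e: "e / 2 > 0" by simp
  obtain \<delta> where \<delta>: "\<delta> > 0"
    and R: "\<forall>s. t < s \<and> s < t + \<delta> \<longrightarrow> dist (rlim g s) (rlim g t) \<le> e / 2"
    and L: "\<forall>s. t - \<delta> < s \<and> s < t \<longrightarrow> dist (rlim g s) (llim g t) \<le> e / 2"
    by (rule GG_local[OF g t e])
  have eq: "llim g t = rlim g t" using J[OF t] by (simp add: jump_def)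
  have "dist (rlim g s) (rlim g t) < e" if "s \<noteq> t" "dist s t < \<delta>" for s
  proof -
    have "t < s \<and> s < t + \<delta> \<or> t - \<delta> < s \<and> s < t" using that by (auto simp: dist_real_def)
    then have "dist (rlim g s) (rlim g t) \<le> e / 2" using R L eq by auto
    then show ?thesis using \<open>e > 0\<close> by simp
  qed
  then show "\<forall>\<^sub>F s in at t. dist (rlim g s) (rlim g t) < e"
    unfolding eventually_at using \<delta> by auto
qed

text \<open>Replacing \<open>g\<close> by \<open>rlim g\<close> changes the quotient only on a null
  set, and the two one-sided limits coincide since \<open>h\<close> has no jump at \<open>t\<close>.
  Continuity of \<open>rlim g\<close> makes the quotient continuous off \<open>t\<close>, so
  \<open>tendsto_at_of_ess\<close> removes the word essential.\<close>

lemma GG_has_vector_derivative_rlim: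
  assumes I: "open I" and g: "g \<in> GG I" and h: "has_GG_deriv I g h"
    and J: "\<And>s. s \<in> I \<Longrightarrow> jump s g = 0" "\<And>s. s \<in> I \<Longrightarrow> jump s h = 0" and t: "t \<in> I"
  shows "(rlim g has_vector_derivative rlim h t) (at t)"
  unfolding has_vector_derivative_at_iff_quotient
proof (rule tendsto_at_of_ess)
  have eq: "llim g t = rlim g t" "llim h t = rlim h t" using J t by (auto simp: jump_def)
  note ae = AE_eventually_ess[OF I t GG_ae_rlim[OF I g]]
  show "((\<lambda>s. (rlim g s - rlim g t) / of_real (s - t)) \<longlongrightarrow> rlim h t) (ess_right t)"
  proof (rule Lim_transform_eventually)
    show "((\<lambda>s. (g s - rlim g t) / of_real (s - t)) \<longlongrightarrow> rlim h t) (ess_right t)"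
      using h t by (simp add: has_GG_deriv_def)
    show "\<forall>\<^sub>F s in ess_right t. (g s - rlim g t) / of_real (s - t) = (rlim g s - rlim g t) / of_real (s - t)"
      using ae(1) by eventually_elim simp
  qed
  show "((\<lambda>s. (rlim g s - rlim g t) / of_real (s - t)) \<longlongrightarrow> rlim h t) (ess_left t)"
  proof (rule Lim_transform_eventually)
    show "((\<lambda>s. (g s - rlim g t) / of_real (s - t)) \<longlongrightarrow> rlim h t) (ess_left t)"
      using h t eq by (auto simp: has_GG_deriv_def)
    show "\<forall>\<^sub>F s in ess_left t. (g s - rlim g t) / of_real (s - t) = (rlim g s - rlim g t) / of_real (s - t)"
      using ae(2) by eventually_elim simp
  qed
  have "isCont (\<lambda>s. (rlim g s - rlim g t) / of_real (s - t)) s" if "s \<in> I" "s \<noteq> t" for s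
    using that by (intro continuous_intros GG_isCont_rlim[OF I g J(1)]) auto
  moreover have "\<forall>\<^sub>F s in at t. s \<in> I \<and> s \<noteq> t"
    using eventually_at_in_open[OF I t] by (auto elim: eventually_mono)
  ultimately show "\<forall>\<^sub>F s in at t. isCont (\<lambda>s. (rlim g s - rlim g t) / of_real (s - t)) s"
    by (auto elim: eventually_mono)
qed

text \<open>The right-limit representatives of the successive derivatives form a classical
  derivative sequence, and the first of them vanishes everywhere on \<open>I\<close> off the
  support.\<close>

lemma RR_without_jumps_DD:
  assumes I: "open I" and g: "g \<in> RR I" and J: "\<And>k t. t \<in> I \<Longrightarrow> jump t (GG_deriv I k g) = 0"
  obtains u where "u \<in> DD I" "u \<in> RR I" "ae_eq I g u"
proof -
  define d where "d = (\<lambda>k. rlim (GG_deriv I k g))"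
  have seq: "GG_deriv_seq I g (\<lambda>k. GG_deriv I k g)" using g by (rule RR_GG_deriv_seq)
  have G: "GG_deriv I k g \<in> GG I" for k using GG_deriv_seq_GG[OF seq RR_GG[OF g]] .
  have D: "(d k has_vector_derivative d (Suc k) t) (at t)" if "t \<in> I" for k t
    unfolding d_def using seq that
    by (intro GG_has_vector_derivative_rlim[OF I G _ J J]) (auto simp: GG_deriv_seq_def)
  have d0: "d 0 = rlim g" using seq by (simp add: d_def GG_deriv_seq_def)
  have K: "compact (GG_supp I g)" "GG_supp I g \<subseteq> I" "\<And>t. t \<in> I - GG_supp I g \<Longrightarrow> d 0 t = 0"
    using g GG_supp_subset by (auto simp: RR_def d0 dest: GG_suppI)
  show thesis
  proof (rule that)
    show "d 0 \<in> DD I" using smooth_DD[OF I D K] by blast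
    show "d 0 \<in> RR I" using smooth_RR[OF I D K] by blast
    show "ae_eq I g (d 0)" unfolding ae_eq_def d0 using GG_ae_rlim[OF I RR_GG[OF g]] .
  qed
qed

subsection \<open>A smooth function with prescribed jet\<close>

definition smooth_fun :: "(real \<Rightarrow> real) \<Rightarrow> bool" where
  "smooth_fun f \<longleftrightarrow> (\<exists>d. d 0 = f \<and> (\<forall>k::nat. \<forall>x. (d k has_real_derivative d (Suc k) x) (at x)))"

text \<open>Smoothness is proved coinductively: it suffices to exhibit a class of functions that is closed
  under differentiation.\<close>

lemma smooth_fun_coinduct:
  assumes "P f" and step: "\<And>g. P g \<Longrightarrow> \<exists>g'. P g' \<and> (\<forall>x. (g has_real_derivative g' x) (at x))"
  shows "smooth_fun f"
proof -
  from step obtain D where D: "\<And>g. P g \<Longrightarrow> P (D g) \<and> (\<forall>x. (g has_real_derivative D g x) (at x))"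
    by metis
  have "P ((D ^^ k) f)" for k by (induction k) (use assms(1) D in auto)
  then show ?thesis unfolding smooth_fun_def using D by (intro exI[of _ "\<lambda>k. (D ^^ k) f"]) auto
qed

lemma smooth_funE:
  assumes "smooth_fun f"
  obtains f' where "smooth_fun f'" "\<And>x. (f has_real_derivative f' x) (at x)"
proof -
  obtain d where d: "d 0 = f" "\<And>k x. (d k has_real_derivative d (Suc k) x) (at x)"
    using assms unfolding smooth_fun_def by blast
  then have "smooth_fun (d 1)"
    unfolding smooth_fun_def by (intro exI[of _ "\<lambda>k. d (Suc k)"]) auto
  with d that show thesis by (metis One_nat_def)
qed

text \<open>Products alone are not closed under differentiation; by the Leibniz rule, sums of
  products are.\<close>

inductive prod_span :: "(real \<Rightarrow> real) \<Rightarrow> bool" where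
  prod: "smooth_fun f \<Longrightarrow> smooth_fun g \<Longrightarrow> prod_span (\<lambda>x. f x * g x)"
| add: "prod_span f \<Longrightarrow> prod_span g \<Longrightarrow> prod_span (\<lambda>x. f x + g x)"

lemma smooth_fun_prod_span: "prod_span f \<Longrightarrow> smooth_fun f"
proof (erule smooth_fun_coinduct)
  fix h assume "prod_span h"
  then show "\<exists>h'. prod_span h' \<and> (\<forall>x. (h has_real_derivative h' x) (at x))"
  proof induction
    case (prod f g)
    obtain f' g' where "smooth_fun f'" "\<And>x. (f has_real_derivative f' x) (at x)"
      "smooth_fun g'" "\<And>x. (g has_real_derivative g' x) (at x)"
      using prod smooth_funE by metis
    then show ?case using prod
      by (intro exI[of _ "\<lambda>x. f' x * g x + f x * g' x"])
        (auto intro!: prod_span.intros derivative_eq_intros)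
  next
    case (add f g)
    then obtain f' g' where "prod_span f'" "\<forall>x. (f has_real_derivative f' x) (at x)"
      "prod_span g'" "\<forall>x. (g has_real_derivative g' x) (at x)" by blast
    then show ?case
      by (intro exI[of _ "\<lambda>x. f' x + g' x"]) (auto intro!: prod_span.intros derivative_eq_intros)
  qed
qed

lemma smooth_fun_mult: "smooth_fun f \<Longrightarrow> smooth_fun g \<Longrightarrow> smooth_fun (\<lambda>x. f x * g x)"
  by (rule smooth_fun_prod_span[OF prod_span.prod])

lemma smooth_fun_poly: "smooth_fun (poly p)"
proof (rule smooth_fun_coinduct[where P = "\<lambda>f. \<exists>p. f = poly p"])
  fix g :: "real \<Rightarrow> real" assume "\<exists>p. g = poly p"
  then show "\<exists>g'. (\<exists>p. g' = poly p) \<and> (\<forall>x. (g has_real_derivative g' x) (at x))"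
    using poly_DERIV by blast
qed blast

text \<open>Reads \<open>f + g\<close> as \<open>f * 1 + g * 1\<close>, a member of
  \<open>prod_span\<close>.\<close>

lemma smooth_fun_add: "smooth_fun f \<Longrightarrow> smooth_fun g \<Longrightarrow> smooth_fun (\<lambda>x. f x + g x)"
  using smooth_fun_prod_span[OF prod_span.add[OF prod_span.prod[of f "poly 1"] prod_span.prod[of g "poly 1"]]]
  by (simp add: smooth_fun_poly)

lemma smooth_fun_affine:
  assumes "smooth_fun f" shows "smooth_fun (\<lambda>x. f (a * x + b))"
proof -
  obtain d where d: "d 0 = f" "\<And>k x. (d k has_real_derivative d (Suc k) x) (at x)"
    using assms unfolding smooth_fun_def by blast
  have "((\<lambda>x. a ^ k * d k (a * x + b)) has_real_derivative a ^ Suc k * d (Suc k) (a * x + b)) (at x)" for k x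
    by (auto intro!: derivative_eq_intros DERIV_chain2[OF d(2)])
  then show ?thesis
    unfolding smooth_fun_def using d(1) by (intro exI[of _ "\<lambda>k x. a ^ k * d k (a * x + b)"]) auto
qed

text \<open>The class of all \<open>f / q ^ n\<close> with smooth \<open>f\<close> is closed under
  differentiation: the new numerator is \<open>f' * q - n * f * q'\<close> and the exponent grows by
  one.\<close>

lemma smooth_fun_divide:
  assumes f: "smooth_fun f" and q: "smooth_fun q" "\<And>x. q x \<noteq> 0"
  shows "smooth_fun (\<lambda>x. f x / q x)"
proof -
  obtain q' where q': "smooth_fun q'" "\<And>x. (q has_real_derivative q' x) (at x)"
    using q smooth_funE by metis
  have "smooth_fun (\<lambda>x. f x / q x ^ 1)"
  proof (rule smooth_fun_coinduct[where P = "\<lambda>g. \<exists>f n. smooth_fun f \<and> g = (\<lambda>x. f x / q x ^ n)"])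
    fix g assume "\<exists>f n. smooth_fun f \<and> g = (\<lambda>x. f x / q x ^ n)"
    then obtain f n where f: "smooth_fun f" and g: "g = (\<lambda>x. f x / q x ^ n)" by blast
    obtain f' where f': "smooth_fun f'" "\<And>x. (f has_real_derivative f' x) (at x)"
      using f smooth_funE by metis
    \<comment> \<open>The constant \<open>- n\<close> is written as a polynomial so that
      \<open>smooth_fun_poly\<close> covers it.\<close>
    let ?F = "\<lambda>x. f' x * q x + f x * (poly [:- real n:] x * q' x)"
    \<comment> \<open>Dividing by \<open>q x\<close> replaces the truncated exponent
      \<open>n - 1\<close> and so includes \<open>n = 0\<close>.\<close>
    have pw: "((\<lambda>x. q x ^ n) has_real_derivative real n * q' x * q x ^ n / q x) (at x)" for x
    proof -
      have "real n * (q' x * q x ^ (n - Suc 0)) = real n * q' x * q x ^ n / q x"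
        using q(2)[of x] by (cases n) auto
      then show ?thesis using DERIV_power[OF q'(2), of n x] by simp
    qed
    have "(g has_real_derivative ?F x / q x ^ Suc n) (at x)" for x
    proof -
      have "(f' x * q x ^ n - f x * (real n * q' x * q x ^ n / q x)) / (q x ^ n * q x ^ n) =
          ?F x / q x ^ Suc n"
        using q(2)[of x] by (simp add: field_simps)
      then show ?thesis unfolding g using DERIV_divide[OF f'(2) pw, of x] q(2)[of x] by simp
    qed
    moreover have "smooth_fun ?F"
      by (intro smooth_fun_add smooth_fun_mult smooth_fun_poly f f' q q')
    ultimately show "\<exists>g'. (\<exists>f n. smooth_fun f \<and> g' = (\<lambda>x. f x / q x ^ n)) \<and>
        (\<forall>x. (g has_real_derivative g' x) (at x))" by blast
  qed (use f in blast)
  then show ?thesis by simp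
qed

section \<open>Flat functions, cut-offs and profiles\<close>

text \<open>The class of functions \<open>p(1/x) exp(-1/x)\<close>, extended by \<open>0\<close>, is closed under differentiation.\<close>

definition flat :: "real poly \<Rightarrow> real \<Rightarrow> real" where
  "flat p x = (if 0 < x then poly p (1 / x) * exp (- (1 / x)) else 0)"

lemma tendsto_poly_div_exp_0: "((\<lambda>x. poly p x / exp x) \<longlongrightarrow> 0) (at_top :: real filter)"
proof -
  have "((\<lambda>x. \<Sum>i\<le>degree p. coeff p i * (x ^ i / exp x)) \<longlongrightarrow> (\<Sum>i\<le>degree p. coeff p i * 0))
      (at_top :: real filter)"
    by (intro tendsto_intros tendsto_power_div_exp_0)
  then show ?thesis by (simp add: poly_altdef sum_divide_distrib)
qed

text \<open>With \<open>y = 1 / x\<close> one has \<open>dy/dx = - y^2\<close>, so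
  \<open>p(y) exp(-y)\<close> has derivative \<open>y^2 (p(y) - p'(y)) exp(-y)\<close>; the factor
  \<open>[:0, 0, 1:]\<close> is \<open>y^2\<close>. At \<open>0\<close> the exponential dominates
  every polynomial in \<open>y\<close>.\<close>

lemma flat_has_derivative:
  "(flat p has_real_derivative flat ([:0, 0, 1:] * (p - pderiv p)) x) (at x)"
proof -
  consider "x > 0" | "x < 0" | "x = 0" by linarith
  then show ?thesis
  proof cases
    case 1
    have "((\<lambda>x. poly p (1 / x) * exp (- (1 / x))) has_real_derivative
        flat ([:0, 0, 1:] * (p - pderiv p)) x) (at x)"
      using 1
      by (auto intro!: derivative_eq_intros DERIV_chain2[OF poly_DERIV]
          simp: flat_def field_simps power2_eq_square)
    then show ?thesis
      by (rule has_field_derivative_transform_within_open[of _ _ _ "{0<..}"]) (use 1 in \<open>auto simp: flat_def\<close>)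
  next
    case 2
    have "((\<lambda>_. 0) has_real_derivative 0) (at x)" by simp
    then have "(flat p has_real_derivative 0) (at x)"
      by (rule has_field_derivative_transform_within_open[of _ _ _ "{..<0}"]) (use 2 in \<open>auto simp: flat_def\<close>)
    then show ?thesis using 2 by (simp add: flat_def)
  next
    case 3
    \<comment> \<open>Dividing by \<open>h\<close> multiplies by \<open>y = 1 / h\<close>, which is
      what \<open>pCons 0\<close> does to \<open>p\<close>.\<close>
    have "((\<lambda>h. poly (pCons 0 p) (inverse h) / exp (inverse h)) \<longlongrightarrow> 0) (at_right 0)"
      using filterlim_compose[OF tendsto_poly_div_exp_0 filterlim_inverse_at_top_right] .
    then have R: "((\<lambda>h. flat p h / h) \<longlongrightarrow> 0) (at_right 0)"
      by (rule Lim_transform_eventually)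
        (auto simp: eventually_at_filter flat_def exp_minus field_simps)
    have L: "((\<lambda>h. flat p h / h) \<longlongrightarrow> 0) (at_left 0)"
      by (rule Lim_transform_eventually[OF tendsto_const]) (auto simp: eventually_at_filter flat_def)
    have "((\<lambda>h. flat p h / h) \<longlongrightarrow> 0) (at 0)"
      using filterlim_split_at[OF L R] .
    then show ?thesis unfolding DERIV_def 3 by (simp add: flat_def)
  qed
qed

lemma smooth_fun_flat: "smooth_fun (flat p)"
proof (rule smooth_fun_coinduct[where P = "\<lambda>f. \<exists>p. f = flat p"])
  fix g :: "real \<Rightarrow> real" assume "\<exists>p. g = flat p"
  then show "\<exists>g'. (\<exists>p. g' = flat p) \<and> (\<forall>x. (g has_real_derivative g' x) (at x))"
    using flat_has_derivative by blast
qed blast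

text \<open>The quotient \<open>h(2 - x) / (h(2 - x) + h(x - 1))\<close> is a smooth step from
  \<open>1\<close> on \<open>x \<le> 1\<close> to \<open>0\<close> on \<open>x \<ge> 2\<close>; its
  product with its reflection is the plateau.\<close>

lemma ex_smooth_plateau:
  obtains b where "smooth_fun b" "\<And>x. \<bar>x\<bar> \<le> 1 \<Longrightarrow> b x = 1" "\<And>x. 2 \<le> \<bar>x\<bar> \<Longrightarrow> b x = 0"
proof -
  define h where "h = flat 1"
  have h: "smooth_fun h" "\<And>x. x \<le> 0 \<Longrightarrow> h x = 0" "\<And>x. x > 0 \<Longrightarrow> h x > 0" "\<And>x. h x \<ge> 0"
    using smooth_fun_flat by (auto simp: h_def flat_def)
  define \<rho> where "\<rho> x = h ((-1) * x + 2) / (h ((-1) * x + 2) + h (1 * x + (-1)))" for x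
  have pos: "h ((-1) * x + 2) + h (1 * x + (-1)) \<noteq> 0" for x
  proof (cases "x < 2")
    case True
    then show ?thesis using h(3)[of "2 - x"] h(4)[of "x - 1"] by simp
  next
    case False
    then show ?thesis using h(4)[of "2 - x"] h(3)[of "x - 1"] by simp
  qed
  have \<rho>: "smooth_fun \<rho>"
    unfolding \<rho>_def[abs_def] by (intro smooth_fun_divide smooth_fun_add smooth_fun_affine h pos)
  have one: "\<rho> x = 1" if "x \<le> 1" for x
    using that pos[of x] h(2)[of "x - 1"] by (simp add: \<rho>_def)
  have zero: "\<rho> x = 0" if "x \<ge> 2" for x
    using that h(2)[of "2 - x"] by (simp add: \<rho>_def)
  show thesis
  proof (rule that[of "\<lambda>x. \<rho> x * \<rho> ((-1) * x + 0)"])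
    show "smooth_fun (\<lambda>x. \<rho> x * \<rho> ((-1) * x + 0))"
      by (intro smooth_fun_mult smooth_fun_affine \<rho>)
  qed (use one zero in \<open>auto simp: abs_if split: if_splits\<close>)
qed

text \<open>Takes \<open>x^k / k!\<close> times the plateau. Near \<open>0\<close> the derivatives
  are those of the polynomial, and at \<open>0\<close> only the \<open>k\<close>-th is non-zero,
  with value \<open>1\<close>.\<close>

lemma ex_jump_profile:
  "\<exists>D. (\<forall>j x. (D j has_real_derivative D (Suc j) x) (at x)) \<and> (\<forall>x. 2 \<le> \<bar>x\<bar> \<longrightarrow> D 0 x = 0) \<and>
     (\<forall>j. D j 0 = (if j = k then 1 else 0 :: real))"
proof -
  obtain b where b: "smooth_fun b" "\<And>x. \<bar>x\<bar> \<le> 1 \<Longrightarrow> b x = 1" "\<And>x. 2 \<le> \<bar>x\<bar> \<Longrightarrow> b x = 0"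
    using ex_smooth_plateau by blast
  define p :: "real poly" where "p = monom (1 / fact k) k"
  have "smooth_fun (\<lambda>x. poly p x * b x)" by (intro smooth_fun_mult smooth_fun_poly b)
  then obtain D where D: "D 0 = (\<lambda>x. poly p x * b x)"
      "\<And>j x. (D j has_real_derivative D (Suc j) x) (at x)"
    unfolding smooth_fun_def by blast
  have "D j x = poly ((pderiv ^^ j) p) x" if "x \<in> {-1<..<1}" for j x
    using that
  proof (induction j arbitrary: x)
    case 0
    then show ?case using b(2)[of x] D(1) by (simp add: abs_le_iff)
  next
    case (Suc j)
    have "(poly ((pderiv ^^ j) p) has_real_derivative D (Suc j) x) (at x)"
      using Suc
      by (intro has_field_derivative_transform_within_open[OF D(2) open_greaterThanLessThan]) auto
    from DERIV_unique[OF this poly_DERIV] show ?case by simp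
  qed
  from this[of 0] have "D j 0 = (if j = k then 1 else 0)" for j
    by (simp add: poly_0_coeff_0 coeff_higher_pderiv p_def pochhammer_fact[symmetric])
  then show ?thesis using D b(3) by (intro exI[of _ D]) auto
qed

subsection \<open>Functions with a single jump\<close>

text \<open>One profile per \<open>k\<close> is fixed for good, so that bounds on its derivatives
  serve all centres \<open>t\<close> and all scales \<open>\<epsilon>\<close>.\<close>

definition profile :: "nat \<Rightarrow> nat \<Rightarrow> real \<Rightarrow> real" where
  "profile k = (SOME D. (\<forall>j x. (D j has_real_derivative D (Suc j) x) (at x)) \<and>
     (\<forall>x. 2 \<le> \<bar>x\<bar> \<longrightarrow> D 0 x = 0) \<and> (\<forall>j. D j 0 = (if j = k then 1 else 0)))"

lemma profile:
  shows profile_deriv: "(profile k j has_real_derivative profile k (Suc j) x) (at x)"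
    and profile_eq_0: "2 \<le> \<bar>x\<bar> \<Longrightarrow> profile k 0 x = 0"
    and profile_at_0: "profile k j 0 = (if j = k then 1 else 0)"
  using someI_ex[OF ex_jump_profile[of k]] unfolding profile_def[symmetric] by blast+

text \<open>\<open>jet t \<epsilon> k j\<close> is the \<open>j\<close>-th derivative of \<open>jet t \<epsilon> k 0\<close>.\<close>

definition jet :: "real \<Rightarrow> real \<Rightarrow> nat \<Rightarrow> nat \<Rightarrow> real \<Rightarrow> complex" where
  "jet t \<epsilon> k j s = of_real (\<epsilon> ^ k / \<epsilon> ^ j * profile k j ((s - t) / \<epsilon>))"

definition jump_fun :: "real \<Rightarrow> real \<Rightarrow> nat \<Rightarrow> real \<Rightarrow> complex" where
  "jump_fun t \<epsilon> k = cut t (jet t \<epsilon> k 0)"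

lemma jet_deriv:
  assumes "\<epsilon> > 0"
  shows "(jet t \<epsilon> k j has_vector_derivative jet t \<epsilon> k (Suc j) s) (at s)"
proof -
  have "((\<lambda>s. profile k j ((s - t) / \<epsilon>)) has_real_derivative
      profile k (Suc j) ((s - t) / \<epsilon>) * (1 / \<epsilon>)) (at s)"
    using assms by (intro DERIV_chain2[OF profile_deriv]) (auto intro!: derivative_eq_intros)
  from DERIV_cmult[OF this, of "\<epsilon> ^ k / \<epsilon> ^ j"]
  have "((\<lambda>s. \<epsilon> ^ k / \<epsilon> ^ j * profile k j ((s - t) / \<epsilon>)) has_real_derivative
      \<epsilon> ^ k / \<epsilon> ^ Suc j * profile k (Suc j) ((s - t) / \<epsilon>)) (at s)"
    using assms by (simp add: mult_ac)
  then show ?thesis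
    unfolding jet_def[abs_def] by (rule has_vector_derivative_of_real)
qed

lemma jet_eq_0:
  assumes "\<epsilon> > 0" "s \<notin> cball t (2 * \<epsilon>)"
  shows "jet t \<epsilon> k 0 s = 0"
proof -
  have "2 \<le> \<bar>(s - t) / \<epsilon>\<bar>" using assms by (auto simp: dist_real_def abs_divide field_simps)
  then show ?thesis by (simp add: jet_def profile_eq_0)
qed

text \<open>The prefactor \<open>\<epsilon> ^ k / \<epsilon> ^ j\<close> equals \<open>1\<close> for
  \<open>j = k\<close>: rescaling keeps the jump of the \<open>k\<close>-th derivative at exactly
  \<open>1\<close> while lower derivatives become small.\<close>

lemma jet_at: "\<epsilon> > 0 \<Longrightarrow> jet t \<epsilon> k j t = (if j = k then 1 else 0)"
  by (simp add: jet_def profile_at_0)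

lemma jet_isCont: "\<epsilon> > 0 \<Longrightarrow> isCont (jet t \<epsilon> k j) s"
  using has_vector_derivative_continuous[OF jet_deriv] .

lemma jet_1: "jet 0 1 k j s = of_real (profile k j s)"
  by (simp add: jet_def)

text \<open>After rescaling, only finitely many profile derivatives need a bound, so
  \<open>M\<close> depends on \<open>m\<close> and \<open>k\<close> but not on \<open>t\<close> or
  \<open>\<epsilon>\<close>.\<close>

lemma jet_bounded:
  obtains M where "M > 0" "\<And>j s t \<epsilon>. \<epsilon> > 0 \<Longrightarrow> j \<le> m \<Longrightarrow> cmod (jet t \<epsilon> k j s) \<le> \<epsilon> ^ k / \<epsilon> ^ j * M"
proof -
  have "\<exists>B. \<forall>s\<in>UNIV. cmod (jet 0 1 k j s) \<le> B" for j
    by (rule smooth_bounded[of UNIV _ "cball 0 (2 * 1)"]) (auto intro!: jet_deriv jet_eq_0)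
  then obtain B where B: "\<And>j s. \<bar>profile k j s\<bar> \<le> B j" unfolding jet_1 by (metis UNIV_I norm_of_real)
  define M where "M = 1 + (\<Sum>j\<le>m. B j)"
  have B0: "B j \<ge> 0" for j using B[of j 0] by linarith
  have M: "M > 0" unfolding M_def by (intro add_pos_nonneg sum_nonneg B0) simp
  have "cmod (jet t \<epsilon> k j s) \<le> \<epsilon> ^ k / \<epsilon> ^ j * M" if "\<epsilon> > 0" "j \<le> m" for j s t \<epsilon>
  proof -
    have "B j \<le> (\<Sum>j\<le>m. B j)" using that B0 by (intro member_le_sum) auto
    then have "\<bar>profile k j ((s - t) / \<epsilon>)\<bar> \<le> M" using B[of j "(s - t) / \<epsilon>"] by (simp add: M_def)
    then have "\<epsilon> ^ k / \<epsilon> ^ j * \<bar>profile k j ((s - t) / \<epsilon>)\<bar> \<le> \<epsilon> ^ k / \<epsilon> ^ j * M"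
      using that by (intro mult_left_mono) auto
    then show ?thesis using that by (simp add: jet_def norm_mult norm_divide norm_power)
  qed
  with M that show thesis by blast
qed

section \<open>Jump functions as test functions and their norms\<close>

context
  fixes I :: "real set" and t \<epsilon> :: real
  assumes I: "open I" and \<epsilon>: "\<epsilon> > 0" and ball: "cball t (2 * \<epsilon>) \<subseteq> I"
begin

lemma jet_RR: "jet t \<epsilon> k 0 \<in> RR I"
  by (rule smooth_RR[where d = "jet t \<epsilon> k" and K = "cball t (2 * \<epsilon>)"])
    (use I ball in \<open>auto intro!: jet_deriv jet_eq_0 \<epsilon>\<close>)

lemma jet_GG_deriv_seq: "GG_deriv_seq I (jet t \<epsilon> k 0) (jet t \<epsilon> k)"
  by (rule smooth_GG_deriv_seq[where d = "jet t \<epsilon> k" and K = "cball t (2 * \<epsilon>)"])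
    (use I ball in \<open>auto intro!: jet_deriv jet_eq_0 \<epsilon>\<close>)

lemma jump_fun_RR: "jump_fun t \<epsilon> k \<in> RR I"
  unfolding jump_fun_def by (rule cut_RR[OF I jet_RR])

lemma jump_fun_GG_deriv_seq: "GG_deriv_seq I (jump_fun t \<epsilon> k) (\<lambda>j. cut t (jet t \<epsilon> k j))"
  unfolding jump_fun_def by (rule cut_GG_deriv_seq[OF I jet_GG_deriv_seq])

lemma jump_fun_GG_deriv: "ae_eq I (GG_deriv I j (jump_fun t \<epsilon> k)) (cut t (jet t \<epsilon> k j))"
  by (rule GG_deriv_ae_eq[OF I RR_GG[OF jump_fun_RR] jump_fun_GG_deriv_seq])

lemma jump_fun_jump:
  assumes "s \<in> I"
  shows "jump s (GG_deriv I j (jump_fun t \<epsilon> k)) = (if j = k \<and> s = t then 1 else 0)"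
  unfolding jump_GG_deriv[OF I RR_GG[OF jump_fun_RR] jump_fun_GG_deriv_seq assms]
    jump_cut_isCont[OF jet_isCont[OF \<epsilon>]]
  using jet_at[OF \<epsilon>] by simp

lemma jump_fun_eq_0: "s \<notin> cball t (2 * \<epsilon>) \<Longrightarrow> jump_fun t \<epsilon> k s = 0"
  using jet_eq_0[OF \<epsilon>] by (simp add: jump_fun_def cut_def)

lemma GG_supp_jump_fun: "GG_supp I (jump_fun t \<epsilon> k) \<subseteq> cball t (2 * \<epsilon>)"
  by (rule GG_supp_subset_of_ae[OF I closed_cball]) (use jump_fun_eq_0 in auto)

text \<open>For orders other than \<open>k\<close> the jet vanishes at \<open>t\<close>, so cutting
  there leaves it continuous; at order \<open>k\<close> the point \<open>t\<close> is the only
  possible discontinuity.\<close>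

lemma jump_fun_RR_F: "jump_fun t \<epsilon> k \<in> RR_F I"
proof -
  obtain M where M: "\<And>j s. cmod (jet t \<epsilon> k j s) \<le> M j"
  proof -
    have "\<exists>B. \<forall>s. cmod (jet t \<epsilon> k j s) \<le> B" for j
      using jet_bounded[of j k] \<epsilon> by (metis order_refl)
    then show thesis using that by metis
  qed
  have "GG_deriv I i (jump_fun t \<epsilon> k) \<in> bdd_cont I" if "i \<noteq> k" for i
  proof -
    \<comment> \<open>Left of \<open>t\<close> the right-hand side is the constant value at
      \<open>t\<close>, which is \<open>0\<close>. Continuity can then be read off as that of a
      composition.\<close>
    have eq: "cut t (jet t \<epsilon> k i) = (\<lambda>s. jet t \<epsilon> k i (max t s))"
      using jet_at[OF \<epsilon>, of t k i] that by (auto simp: cut_def max_def)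
    have "continuous_on UNIV (jet t \<epsilon> k i)"
      using jet_isCont[OF \<epsilon>] by (simp add: continuous_at_imp_continuous_on)
    then have "continuous_on I (\<lambda>s. jet t \<epsilon> k i (max t s))"
      by (rule continuous_on_compose2) (auto intro!: continuous_intros)
    then have "continuous_on I (cut t (jet t \<epsilon> k i))" using eq by simp
    moreover have "bounded (cut t (jet t \<epsilon> k i) ` I)"
      unfolding bounded_iff using M[of i] order_trans[OF norm_ge_zero M[of i t]]
      by (intro exI[of _ "M i"]) (auto simp: cut_def)
    ultimately show ?thesis
      unfolding bdd_cont_def using jump_fun_GG_deriv by (intro CollectI exI conjI)
  qed
  moreover have "GG_deriv I k (jump_fun t \<epsilon> k) \<in> piecewise_cont I"
  proof -
    have "isCont (cut t (jet t \<epsilon> k k)) s" if "s \<noteq> t" for s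
    proof (cases "t < s")
      case True
      then have "\<forall>\<^sub>F x in nhds s. cut t (jet t \<epsilon> k k) x = jet t \<epsilon> k k x"
        by (intro eventually_nhds[THEN iffD2] exI[of _ "{t<..}"]) (auto simp: cut_def)
      from isCont_cong[OF this] show ?thesis using jet_isCont[OF \<epsilon>] by blast
    next
      case False
      then have "\<forall>\<^sub>F x in nhds s. cut t (jet t \<epsilon> k k) x = 0"
        using that by (intro eventually_nhds[THEN iffD2] exI[of _ "{..<t}"]) (auto simp: cut_def)
      from isCont_cong[OF this] show ?thesis by simp
    qed
    then have "{s \<in> K. \<not> isCont (cut t (jet t \<epsilon> k k)) s} \<subseteq> {t}" for K by blast
    then have "finite {s \<in> K. \<not> isCont (cut t (jet t \<epsilon> k k)) s}" for K
      by (rule finite_subset) simp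
    then show ?thesis
      unfolding piecewise_cont_def using jump_fun_GG_deriv
      by (intro CollectI exI[of _ "cut t (jet t \<epsilon> k k)"]) simp
  qed
  ultimately have "jump_fun t \<epsilon> k \<in> FF_at I k"
    using jump_fun_RR by (auto simp: FF_at_def RR_def)
  then have "jump_fun t \<epsilon> k \<in> FF I"
    unfolding FF_def
    by (intro CollectI exI[of _ "{jump_fun t \<epsilon> k}"] exI[of _ "\<lambda>_. 1"]) auto
  then show ?thesis using jump_fun_RR by (simp add: RR_F_def)
qed

lemma jump_fun_scale_GG_deriv_seq:
  "GG_deriv_seq I (\<lambda>s. \<alpha> * jump_fun t \<epsilon> k s) (\<lambda>j s. \<alpha> * cut t (jet t \<epsilon> k j) s)"
  using GG_deriv_seq_lincomb[OF I RR_GG[OF jump_fun_RR] RR_GG[OF jump_fun_RR]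
      jump_fun_GG_deriv_seq jump_fun_GG_deriv_seq, where \<beta> = 0] by simp

lemma jump_fun_scale_RR: "(\<lambda>s. \<alpha> * jump_fun t \<epsilon> k s) \<in> RR I"
  using RR_lincomb[OF I jump_fun_RR jump_fun_RR, where \<beta> = 0] by simp

text \<open>For \<open>j \<le> m < k\<close> and \<open>\<epsilon> \<le> 1\<close> the prefactor
  \<open>\<epsilon> ^ k / \<epsilon> ^ j\<close> is at most \<open>\<epsilon>\<close>. All norms of
  order below \<open>k\<close> thus tend to \<open>0\<close> linearly in
  \<open>\<epsilon>\<close>.\<close>

lemma GG_norm_jump_fun:
  assumes "\<epsilon> \<le> 1" "m < k" and M: "\<And>j s. j \<le> m \<Longrightarrow> cmod (jet t \<epsilon> k j s) \<le> \<epsilon> ^ k / \<epsilon> ^ j * M" "M > 0"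
  shows "GG_norm I m (\<lambda>s. \<alpha> * jump_fun t \<epsilon> k s) \<le> ereal (cmod \<alpha> * (\<epsilon> * M))"
proof -
  have "ess_norm I (GG_deriv I j (\<lambda>s. \<alpha> * jump_fun t \<epsilon> k s)) \<le> ereal (cmod \<alpha> * (\<epsilon> * M))"
    if j: "j \<le> m" for j
  proof -
    let ?h = "GG_deriv I j (\<lambda>s. \<alpha> * jump_fun t \<epsilon> k s)"
    have "?h \<in> GG I"
      using GG_deriv_seq_GG[OF RR_GG_deriv_seq RR_GG] jump_fun_scale_RR by blast
    then have m: "?h \<in> borel_measurable (lebesgue_on I)" by (simp add: GG_iff[OF I])
    have "\<epsilon> ^ k / \<epsilon> ^ j = \<epsilon> * \<epsilon> ^ (k - j - 1)"
      using \<epsilon> j \<open>m < k\<close> by (simp add: power_diff[symmetric] power_Suc[symmetric] Suc_diff_Suc del: power_Suc)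
    also have "\<dots> \<le> \<epsilon>" using \<epsilon> \<open>\<epsilon> \<le> 1\<close> by (simp add: mult_left_le power_le_one)
    finally have le: "cmod (jet t \<epsilon> k j s) \<le> \<epsilon> * M" for s
      using M(1)[OF j, of s] M(2) by (meson mult_right_mono less_imp_le order_trans)
    have "cmod (\<alpha> * cut t (jet t \<epsilon> k j) s) \<le> cmod \<alpha> * (\<epsilon> * M)" for s
      using le[of s] M(2) \<epsilon> by (auto simp: cut_def norm_mult intro!: mult_left_mono)
    moreover have "AE s in lebesgue. s \<in> I \<longrightarrow> ?h s = \<alpha> * cut t (jet t \<epsilon> k j) s"
      using GG_deriv_ae_eq[OF I RR_GG[OF jump_fun_scale_RR] jump_fun_scale_GG_deriv_seq]
      unfolding ae_eq_def by blast
    ultimately have "AE s in lebesgue_on I. ereal (cmod (?h s)) \<le> ereal (cmod \<alpha> * (\<epsilon> * M))"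
      unfolding AE_lebesgue_on_open[OF I] by (auto elim: eventually_mono)
    then show ?thesis unfolding ess_norm_def by (intro esssup_I) (use m in auto)
  qed
  then show ?thesis unfolding GG_norm_def by (intro Max.boundedI) auto
qed

end

subsection \<open>Functionals vanishing on smooth test functions\<close>

lemma RR_scale:
  assumes "open I" "\<phi> \<in> RR I" shows "(\<lambda>t. \<alpha> * \<phi> t) \<in> RR I"
  using RR_lincomb[OF assms(1) assms(2) assms(2), where \<beta> = 0] by simp

lemma RR_dualD:
  assumes "f \<in> RR_dual I"
  shows RR_dual_ae_eq: "\<And>\<phi> \<psi>. \<phi> \<in> RR I \<Longrightarrow> \<psi> \<in> RR I \<Longrightarrow> ae_eq I \<phi> \<psi> \<Longrightarrow> f \<phi> = f \<psi>"
    and RR_dual_add: "\<And>\<phi> \<psi>. \<phi> \<in> RR I \<Longrightarrow> \<psi> \<in> RR I \<Longrightarrow> f (\<lambda>t. \<phi> t + \<psi> t) = f \<phi> + f \<psi>"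
    and RR_dual_scale: "\<And>\<alpha> \<phi>. \<phi> \<in> RR I \<Longrightarrow> f (\<lambda>t. \<alpha> * \<phi> t) = \<alpha> * f \<phi>"
    and RR_dual_continuous_map: "continuous_map (RR_topology I) euclidean f"
proof -
  note D = assms[unfolded RR_dual_def mem_Collect_eq]
  show "\<And>\<phi> \<psi>. \<phi> \<in> RR I \<Longrightarrow> \<psi> \<in> RR I \<Longrightarrow> ae_eq I \<phi> \<psi> \<Longrightarrow> f \<phi> = f \<psi>"
    by (rule D[THEN conjunct1, rule_format])
  show "\<And>\<phi> \<psi>. \<phi> \<in> RR I \<Longrightarrow> \<psi> \<in> RR I \<Longrightarrow> f (\<lambda>t. \<phi> t + \<psi> t) = f \<phi> + f \<psi>"
    by (rule D[THEN conjunct2, THEN conjunct1, rule_format])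
  show "\<And>\<alpha> \<phi>. \<phi> \<in> RR I \<Longrightarrow> f (\<lambda>t. \<alpha> * \<phi> t) = \<alpha> * f \<phi>"
    by (rule D[THEN conjunct2, THEN conjunct2, THEN conjunct1, rule_format])
  show "continuous_map (RR_topology I) euclidean f"
    by (rule D[THEN conjunct2, THEN conjunct2, THEN conjunct2])
qed

lemma RR_dual_lincomb:
  assumes I: "open I" and f: "f \<in> RR_dual I" and \<phi>: "\<phi> \<in> RR I" and \<psi>: "\<psi> \<in> RR I"
  shows "f (\<lambda>t. \<alpha> * \<phi> t + \<beta> * \<psi> t) = \<alpha> * f \<phi> + \<beta> * f \<psi>"
  using RR_dual_add[OF f RR_scale[OF I \<phi>] RR_scale[OF I \<psi>]]
    RR_dual_scale[OF f \<phi>] RR_dual_scale[OF f \<psi>] by simp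

lemma RR_dual_0: "open I \<Longrightarrow> f \<in> RR_dual I \<Longrightarrow> f (\<lambda>_. 0) = 0"
  using RR_dual_lincomb[of I f "\<lambda>_. 0" "\<lambda>_. 0" 0 0] RR_0 by simp

lemma RR_dual_sum:
  assumes I: "open I" and f: "f \<in> RR_dual I" and "finite S" "\<And>x. x \<in> S \<Longrightarrow> h x \<in> RR I"
  shows "f (\<lambda>t. \<Sum>x\<in>S. \<alpha> x * h x t) = (\<Sum>x\<in>S. \<alpha> x * f (h x))"
  using assms(3,4)
proof (induction S rule: finite_induct)
  case empty
  show ?case using RR_dual_0[OF I f] by simp
next
  case (insert x S)
  then show ?case
    using RR_dual_lincomb[OF I f, of "h x" "\<lambda>t. \<Sum>x\<in>S. \<alpha> x * h x t" "\<alpha> x" 1]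
      RR_sum[OF I insert(1), of h \<alpha>] by simp
qed

section \<open>Finite jump sets and the expansion on \<open>RR_F I\<close>\<close>

definition jumps :: "real set \<Rightarrow> (real \<Rightarrow> complex) \<Rightarrow> (nat \<times> real) set" where
  "jumps I \<phi> = {(k, t). t \<in> I \<and> jump t (GG_deriv I k \<phi>) \<noteq> 0}"

text \<open>A jump of the \<open>k\<close>-th derivative must come from a summand in
  \<open>FF_at I k\<close>, since the other summands have a continuous \<open>k\<close>-th
  derivative. On the compact support of \<open>\<phi>\<close> each summand has finitely many
  discontinuities of its exceptional derivative.\<close>

lemma finite_jumps:
  assumes I: "open I" and \<phi>: "\<phi> \<in> RR_F I"
  shows "finite (jumps I \<phi>)"
proof -
  obtain S \<alpha> where S: "finite S" "S \<subseteq> (\<Union>k. FF_at I k)" "\<phi> = (\<lambda>t. \<Sum>h\<in>S. \<alpha> h * h t)"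
    using \<phi> unfolding RR_F_def FF_def by blast
  from S(2) have "\<forall>h\<in>S. \<exists>k. h \<in> FF_at I k" by blast
  \<comment> \<open>\<open>\<kappa> h\<close> is the single order at which the summand
    \<open>h\<close> may jump.\<close>
  then obtain \<kappa> where \<kappa>: "\<And>h. h \<in> S \<Longrightarrow> h \<in> FF_at I (\<kappa> h)" by metis
  then have "\<forall>h\<in>S. \<exists>p. ae_eq I (GG_deriv I (\<kappa> h) h) p \<and>
      (\<forall>K. compact K \<and> K \<subseteq> I \<longrightarrow> finite {t \<in> K. \<not> isCont p t})"
    unfolding FF_at_def piecewise_cont_def by blast
  then obtain p where p: "\<And>h. h \<in> S \<Longrightarrow> ae_eq I (GG_deriv I (\<kappa> h) h) (p h)"
    "\<And>h K. h \<in> S \<Longrightarrow> compact K \<Longrightarrow> K \<subseteq> I \<Longrightarrow> finite {t \<in> K. \<not> isCont (p h) t}"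
    by metis
  have RR: "\<phi> \<in> RR I" using \<phi> by (simp add: RR_F_def)
  let ?K = "GG_supp I \<phi>"
  have K: "compact ?K" "?K \<subseteq> I" using RR GG_supp_subset by (auto simp: RR_def)
  have "jumps I \<phi> \<subseteq> (\<Union>h\<in>S. {\<kappa> h} \<times> {t \<in> ?K. \<not> isCont (p h) t})"
  proof (clarsimp simp: jumps_def)
    fix k t assume t: "t \<in> I" and j: "jump t (GG_deriv I k \<phi>) \<noteq> 0"
    have "t \<in> ?K"
    proof (rule ccontr)
      assume "t \<notin> ?K"
      with t j show False
        using deriv_eq_0_off_supp[OF I RR_GG[OF RR] RR_GG_deriv_seq[OF RR], of t k]
        by (simp add: jump_def)
    qed
    have "jump t (GG_deriv I k \<phi>) = (\<Sum>h\<in>S. \<alpha> h * jump t (GG_deriv I k h))"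
      unfolding S(3) using GG_inf_sum[OF I S(1), of "\<lambda>h. h" \<alpha> k] \<kappa> t by (auto simp: FF_at_def)
    with j obtain h where h: "h \<in> S" "jump t (GG_deriv I k h) \<noteq> 0"
      by (metis (no_types, lifting) mult_zero_right sum.neutral)
    have k: "k = \<kappa> h"
    proof (rule ccontr)
      assume "k \<noteq> \<kappa> h"
      then obtain q where q: "ae_eq I (GG_deriv I k h) q" "continuous_on I q"
        using \<kappa>[OF h(1)] unfolding FF_at_def bdd_cont_def by blast
      then have "isCont q t" using I t continuous_on_eq_continuous_at by blast
      then have "jump t (GG_deriv I k h) = 0"
        using ae_eq_jump[OF I t q(1)] isCont_rlim_llim[of t q] by (simp add: jump_def)
      with h show False by blast
    qed
    have "\<not> isCont (p h) t"
      using ae_eq_jump[OF I t p(1)[OF h(1)]] isCont_rlim_llim[of t "p h"] h(2) k by (auto simp: jump_def)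
    with h(1) k \<open>t \<in> ?K\<close> show "\<exists>h\<in>S. k = \<kappa> h \<and> t \<in> ?K \<and> \<not> isCont (p h) t" by blast
  qed
  then show ?thesis
    by (rule finite_subset) (use S(1) p(2) K in auto)
qed

lemma jump_terms_subset: "jump_terms I c \<phi> \<subseteq> jumps I \<phi>"
  by (auto simp: jump_terms_def jumps_def)

text \<open>Exchanges the index set \<open>jump_terms\<close>, which depends on \<open>c\<close>,
  for one depending on \<open>\<phi>\<close> alone; the added terms are zero.\<close>

lemma jump_sum_eq:
  assumes "finite (jumps I \<phi>)"
  shows "jump_sum I c \<phi> = (\<Sum>(k, t)\<in>jumps I \<phi>. c k t * jump t (GG_deriv I k \<phi>))"
  unfolding jump_sum_def
  by (rule sum.mono_neutral_left[OF assms jump_terms_subset]) (auto simp: jump_terms_def jumps_def)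

text \<open>Jump functions are dual to the coefficients: each one isolates a single
  \<open>c k t\<close>.\<close>

lemma jump_sum_jump_fun:
  assumes "open I" "\<epsilon> > 0" "cball t (2 * \<epsilon>) \<subseteq> I"
  shows "jump_sum I c (jump_fun t \<epsilon> k) = c k t"
proof -
  have t: "t \<in> I" using assms by auto
  have "jumps I (jump_fun t \<epsilon> k) = {(k, t)}"
    using t jump_fun_jump[OF assms] by (auto simp: jumps_def split: if_splits)
  then show ?thesis using t jump_fun_jump[OF assms] by (simp add: jump_sum_eq)
qed

lemma ker_Gam_DD: "f \<in> ker_Gam I \<Longrightarrow> u \<in> DD I \<Longrightarrow> f u = 0"
  unfolding ker_Gam_def Gam_def by (auto dest: fun_cong[of _ _ u])

text \<open>Subtracting the matching jump functions leaves an element without jumps, i.e. one of \<open>DD I\<close>.\<close>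

lemma ker_Gam_expansion:
  assumes I: "open I" and f: "f \<in> ker_Gam I" and \<phi>: "\<phi> \<in> RR I" and fin: "finite (jumps I \<phi>)"
    and r: "\<And>t. t \<in> I \<Longrightarrow> r t > 0 \<and> cball t (2 * r t) \<subseteq> I"
  shows "f \<phi> = (\<Sum>(k, t)\<in>jumps I \<phi>. f (jump_fun t (r t) k) * jump t (GG_deriv I k \<phi>))"
proof -
  have fd: "f \<in> RR_dual I" using f by (simp add: ker_Gam_def)
  define h where "h = (\<lambda>(k, t). jump_fun t (r t) k)"
  define \<alpha> where "\<alpha> = (\<lambda>(k, t). jump t (GG_deriv I k \<phi>))"
  define \<Sigma> where "\<Sigma> = (\<lambda>s. \<Sum>x\<in>jumps I \<phi>. \<alpha> x * h x s)"
  define \<psi> where "\<psi> = (\<lambda>s. 1 * \<phi> s + (-1) * \<Sigma> s)"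
  have h: "h x \<in> RR I" if "x \<in> jumps I \<phi>" for x
    using that jump_fun_RR[OF I] r by (auto simp: jumps_def h_def)
  have \<Sigma>: "\<Sigma> \<in> RR I" unfolding \<Sigma>_def by (rule RR_sum[OF I fin h])
  have \<psi>: "\<psi> \<in> RR I" unfolding \<psi>_def by (rule RR_lincomb[OF I \<phi> \<Sigma>])
  have inf: "g \<in> GG_inf I" if "g \<in> RR I" for g using that by (simp add: RR_def)
  have "jump t (GG_deriv I k \<psi>) = 0" if t: "t \<in> I" for k t
  proof -
    have "jump t (GG_deriv I k \<Sigma>) = (\<Sum>x\<in>jumps I \<phi>. \<alpha> x * jump t (GG_deriv I k (h x)))"
      unfolding \<Sigma>_def using GG_inf_sum[OF I fin, of h \<alpha> k] inf[OF h] t by blast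
    also have "\<dots> = (\<Sum>x\<in>jumps I \<phi>. if x = (k, t) then \<alpha> x else 0)"
    proof (rule sum.cong[OF refl])
      fix x assume "x \<in> jumps I \<phi>"
      then obtain l s where x: "x = (l, s)" "s \<in> I" by (auto simp: jumps_def)
      then have "jump t (GG_deriv I k (h x)) = (if k = l \<and> t = s then 1 else 0)"
        using jump_fun_jump[OF I _ _ t] r by (simp add: h_def)
      then show "\<alpha> x * jump t (GG_deriv I k (h x)) = (if x = (k, t) then \<alpha> x else 0)"
        using x by auto
    qed
    \<comment> \<open>If \<open>(k, t)\<close> is not in the jump set, both sides are
      \<open>0\<close>.\<close>
    also have "\<dots> = jump t (GG_deriv I k \<phi>)"
      using fin t by (auto simp: sum.delta \<alpha>_def jumps_def)
    finally show ?thesis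
      unfolding \<psi>_def using GG_deriv_lincomb_jump[OF I inf[OF \<phi>] inf[OF \<Sigma>] t, of k 1 "-1"] by simp
  qed
  then obtain u where u: "u \<in> DD I" "u \<in> RR I" "ae_eq I \<psi> u"
    using RR_without_jumps_DD[OF I \<psi>] by blast
  have "f \<psi> = 0" using RR_dual_ae_eq[OF fd \<psi> u(2,3)] ker_Gam_DD[OF f u(1)] by simp
  then have "f \<phi> = f \<Sigma>" unfolding \<psi>_def RR_dual_lincomb[OF I fd \<phi> \<Sigma>] by simp
  also have "\<dots> = (\<Sum>x\<in>jumps I \<phi>. \<alpha> x * f (h x))"
    unfolding \<Sigma>_def by (rule RR_dual_sum[OF I fd fin h])
  finally show ?thesis by (simp add: \<alpha>_def h_def case_prod_unfold mult.commute)
qed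

lemma ex_cball_double:
  fixes t :: real
  assumes "open U" "t \<in> U"
  shows "\<exists>r>0. cball t (2 * r) \<subseteq> U"
proof -
  obtain e where "e > 0" "cball t e \<subseteq> U"
    using assms open_contains_cball by blast
  then show ?thesis by (intro exI[of _ "e / 2"]) simp
qed

text \<open>Since every admissible \<open>\<epsilon>\<close> gives the same value, this yields
  uniqueness of the coefficients and leaves \<open>\<epsilon>\<close> free to be shrunk
  later.\<close>

lemma jump_expansion_jump_fun:
  assumes "open I" "jump_expansion I f c" "\<epsilon> > 0" "cball t (2 * \<epsilon>) \<subseteq> I"
  shows "f (jump_fun t \<epsilon> k) = c k t"
proof -
  obtain F where F: "\<And>\<phi>. \<phi> \<in> RR_F I \<Longrightarrow> F \<phi> = jump_sum I c \<phi>" "\<And>\<phi>. \<phi> \<in> RR I \<Longrightarrow> f \<phi> = F \<phi>"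
    using assms(2) unfolding jump_expansion_def continuous_extension_def by blast
  have "jump_fun t \<epsilon> k \<in> RR_F I" "jump_fun t \<epsilon> k \<in> RR I"
    using jump_fun_RR_F jump_fun_RR assms by blast+
  then show ?thesis using F jump_sum_jump_fun[OF assms(1,3,4)] by metis
qed

section \<open>Local finite order and vanishing of high coefficients\<close>

lemma RR_dual_continuous_at_0:
  assumes I: "open I" and f: "f \<in> RR_dual I" and J: "is_interval J" "bounded J" "closure J \<subseteq> I"
  obtains m e where "e > 0"
    "\<And>\<phi>. \<phi> \<in> RR I \<Longrightarrow> \<phi> \<in> GG_inf_on I J \<Longrightarrow> GG_norm I m \<phi> < ereal e \<Longrightarrow> cmod (f \<phi>) < 1"
proof -
  have "openin (RR_topology I) {\<phi> \<in> topspace (RR_topology I). f \<phi> \<in> ball 0 1}"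
    by (rule openin_continuous_map_preimage[OF RR_dual_continuous_map[OF f]]) simp
  then have "RR_open I {\<phi> \<in> RR I. cmod (f \<phi>) < 1}"
    by (simp add: openin_RR_topology)
  moreover have "(\<lambda>_. 0) \<in> {\<phi> \<in> RR I. cmod (f \<phi>) < 1}"
    using RR_0[OF I] RR_dual_0[OF I f] by simp
  \<comment> \<open>Openness is used at the base point \<open>0\<close>, where the translate
    \<open>\<psi> - 0\<close> is \<open>\<psi>\<close> itself. On the step \<open>J\<close>, such a
    \<open>V\<close> contains a ball of a single norm.\<close>
  ultimately have "\<exists>V. RR_nhd0 I V \<and> (\<forall>\<psi>\<in>RR I. \<psi> \<in> V \<longrightarrow> cmod (f \<psi>) < 1)"
    unfolding RR_open_def by fastforce
  then obtain V where V: "RR_nhd0 I V" "\<And>\<psi>. \<psi> \<in> RR I \<Longrightarrow> \<psi> \<in> V \<Longrightarrow> cmod (f \<psi>) < 1"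
    by blast
  obtain m e where "e > 0" "{\<phi> \<in> GG_inf_on I J. GG_norm I m \<phi> < ereal e} \<subseteq> V"
    using V(1) J unfolding RR_nhd0_def by blast
  then show thesis using V(2) by (intro that[of e m]) auto
qed

text \<open>If \<open>c k t\<close> were non-zero for some \<open>k > m\<close>, rescaled jump
  functions would all have value \<open>1\<close> under \<open>f\<close>, while their norm of order
  \<open>m\<close> tends to \<open>0\<close>. This contradicts the bound \<open>< 1\<close> on small
  functions.\<close>

lemma jump_expansion_eventually_0:
  assumes I: "open I" and f: "f \<in> RR_dual I" and c: "jump_expansion I f c" and t: "t \<in> I"
  shows "\<exists>k0. \<forall>k\<ge>k0. c k t = 0"
proof -
  obtain r where r: "r > 0" "cball t (2 * r) \<subseteq> I"
    using ex_cball_double[OF I t] by blast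
  let ?J = "cball t (2 * r)"
  obtain m e where e: "e > 0"
    "\<And>\<phi>. \<phi> \<in> RR I \<Longrightarrow> \<phi> \<in> GG_inf_on I ?J \<Longrightarrow> GG_norm I m \<phi> < ereal e \<Longrightarrow> cmod (f \<phi>) < 1"
    by (rule RR_dual_continuous_at_0[OF I f, of ?J]) (use r in \<open>auto simp: is_interval_cball_1\<close>)
  have "c k t = 0" if k: "m < k" for k
  proof (rule ccontr)
    assume nz: "c k t \<noteq> 0"
    define \<alpha> where "\<alpha> = 1 / c k t"
    obtain M where M: "M > 0"
      "\<And>j s t \<epsilon>. \<epsilon> > 0 \<Longrightarrow> j \<le> m \<Longrightarrow> cmod (jet t \<epsilon> k j s) \<le> \<epsilon> ^ k / \<epsilon> ^ j * M"
      by (rule jet_bounded[of m k]) blast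
    \<comment> \<open>The bound \<open>1\<close> serves the norm estimate, \<open>r\<close> keeps
      the support in \<open>?J\<close>, and the last term brings the norm down to at most
      \<open>e / 2\<close>.\<close>
    define \<epsilon> where "\<epsilon> = min (min 1 r) (e / (2 * cmod \<alpha> * M))"
    have \<alpha>: "cmod \<alpha> > 0" using nz by (simp add: \<alpha>_def)
    have \<epsilon>: "\<epsilon> > 0" "\<epsilon> \<le> 1" "\<epsilon> \<le> r" "\<epsilon> \<le> e / (2 * cmod \<alpha> * M)"
      using r e \<alpha> M by (auto simp: \<epsilon>_def)
    have sub: "cball t (2 * \<epsilon>) \<subseteq> ?J" using \<epsilon> by auto
    then have ball: "cball t (2 * \<epsilon>) \<subseteq> I" using r by blast
    have "cmod \<alpha> * (\<epsilon> * M) \<le> e / 2" using \<epsilon>(4) \<alpha> M by (simp add: field_simps)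
    then have "cmod \<alpha> * (\<epsilon> * M) < e" using e(1) by linarith
    then have "GG_norm I m (\<lambda>s. \<alpha> * jump_fun t \<epsilon> k s) < ereal e"
      using GG_norm_jump_fun[OF I \<epsilon>(1) ball \<epsilon>(2) k M(2)[OF \<epsilon>(1)] M(1), of \<alpha>]
      by (meson ereal_less(2) le_less_trans less_ereal.simps(1))
    moreover have RR: "(\<lambda>s. \<alpha> * jump_fun t \<epsilon> k s) \<in> RR I"
      by (rule jump_fun_scale_RR[OF I \<epsilon>(1) ball])
    moreover have "(\<lambda>s. \<alpha> * jump_fun t \<epsilon> k s) \<in> GG_inf_on I ?J"
    proof -
      have "\<forall>s. s \<notin> ?J \<longrightarrow> jump_fun t \<epsilon> k s = 0"
        using jump_fun_eq_0[OF I \<epsilon>(1) ball] sub by blast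
      then have "ae_eq (I - ?J) (\<lambda>s. \<alpha> * jump_fun t \<epsilon> k s) (\<lambda>_. 0)"
        unfolding ae_eq_def by (intro AE_I2) auto
      then show ?thesis using RR by (simp add: GG_inf_on_def RR_def)
    qed
    ultimately have "cmod (f (\<lambda>s. \<alpha> * jump_fun t \<epsilon> k s)) < 1" using e(2) by blast
    moreover have "f (\<lambda>s. \<alpha> * jump_fun t \<epsilon> k s) = \<alpha> * c k t"
      using RR_dual_lincomb[OF I f jump_fun_RR[OF I \<epsilon>(1) ball] jump_fun_RR[OF I \<epsilon>(1) ball], where \<beta> = 0]
        jump_expansion_jump_fun[OF I c \<epsilon>(1) ball] by simp
    ultimately show False using nz by (simp add: \<alpha>_def)
  qed
  then show ?thesis by (intro exI[of _ "Suc m"]) auto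
qed

subsection \<open>Supports of functionals\<close>

text \<open>The candidate for the least set is the intersection of all admissible ones; the point is
  that it is admissible too. For \<open>\<phi>\<close> supported off it,
  \<open>f (cut u \<phi>)\<close> is locally constant in \<open>u\<close>, because a thin slice of
  \<open>\<phi>\<close> avoids one single admissible set. Moving \<open>u\<close> across the support
  leads from \<open>f \<phi>\<close> to \<open>0\<close>.\<close>

lemma RR_dual_supp:
  assumes I: "open I" "is_interval I" and f: "f \<in> RR_dual I"
  shows "closedin (top_of_set I) (RR_dual_supp I f) \<and>
    (\<forall>\<phi>\<in>RR I. GG_supp I \<phi> \<inter> RR_dual_supp I f = {} \<longrightarrow> f \<phi> = 0)"
proof -
  define N where "N S \<longleftrightarrow> closedin (top_of_set I) S \<and> (\<forall>\<phi>\<in>RR I. GG_supp I \<phi> \<inter> S = {} \<longrightarrow> f \<phi> = 0)"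
    for S
  define S0 where "S0 = \<Inter>(Collect N)"
  have empty: "f \<phi> = 0" if "\<phi> \<in> RR I" "GG_supp I \<phi> = {}" for \<phi>
  proof -
    have "ae_eq I \<phi> (\<lambda>_. 0)"
      using GG_supp_eq_0_ae[OF I(1) RR_GG[OF that(1)]] that(2) by (simp add: ae_eq_def)
    then show ?thesis using RR_dual_ae_eq[OF f that(1) RR_0[OF I(1)]] RR_dual_0[OF I(1) f] by simp
  qed
  \<comment> \<open>Ensures that the intersected family is non-empty, so that \<open>S0\<close> is
    closed in \<open>I\<close>.\<close>
  have NI: "N I"
    unfolding N_def using empty GG_supp_subset by (auto simp: Int_absorb2)
  have cl: "closedin (top_of_set I) S0"
    unfolding S0_def using NI by (intro closedin_Inter) (auto simp: N_def)
  have "f \<phi> = 0" if \<phi>: "\<phi> \<in> RR I" and disj: "GG_supp I \<phi> \<inter> S0 = {}" for \<phi>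
  proof (cases "GG_supp I \<phi> = {}")
    case True
    then show ?thesis using empty \<phi> by blast
  next
    case False
    let ?K = "GG_supp I \<phi>"
    have K: "compact ?K" "?K \<subseteq> I" using \<phi> GG_supp_subset by (auto simp: RR_def)
    obtain m where m: "m \<in> ?K" "\<And>x. x \<in> ?K \<Longrightarrow> m \<le> x"
      using compact_attains_inf[OF K(1) False] by blast
    obtain M where M: "M \<in> ?K" "\<And>x. x \<in> ?K \<Longrightarrow> x \<le> M"
      using compact_attains_sup[OF K(1) False] by blast
    obtain A where A: "A \<in> I" "A < m"
    proof -
      obtain e where "e > 0" "cball m e \<subseteq> I" using I(1) m(1) K(2) open_contains_cball by blast
      then show thesis by (intro that[of "m - e"]) (auto simp: subset_iff dist_real_def)
    qed
    obtain B where B: "B \<in> I" "M < B"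
    proof -
      obtain e where "e > 0" "cball M e \<subseteq> I" using I(1) M(1) K(2) open_contains_cball by blast
      then show thesis by (intro that[of "M + e"]) (auto simp: subset_iff dist_real_def)
    qed
    have AB: "A \<le> B" using A B m M by force
    have cut: "cut u \<phi> \<in> RR I" for u using cut_RR[OF I(1) \<phi>] .
    \<comment> \<open>Cutting at \<open>A\<close>, left of the support, keeps all of
      \<open>\<phi>\<close>; cutting at \<open>B\<close>, right of it, leaves
      \<open>0\<close>.\<close>
    have "f (cut A \<phi>) = f (cut B \<phi>)"
      using AB
    proof (induction rule: Bolzano)
      case (trans a b c)
      then show ?case by simp
    next
      case (local x)
      have x: "x \<in> I" using local A B I(2) by (meson is_interval_1)
      have "\<exists>S e. N S \<and> e > 0 \<and> (\<forall>y\<in>ball x e. y \<in> I \<and> (y \<in> ?K \<longrightarrow> y \<notin> S))"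
      proof (cases "x \<in> ?K")
        case True
        with disj obtain S where S: "N S" "x \<notin> S" unfolding S0_def by blast
        have "openin (top_of_set I) (I - S)" using S(1) by (auto simp: N_def closedin_def)
        then have "open (I - S)" using I(1) openin_open_eq by blast
        then obtain e where "e > 0" "ball x e \<subseteq> I - S" using x S(2) openE by blast
        then show ?thesis using S(1) by blast
      next
        \<comment> \<open>Near \<open>x\<close> there are no points of the support at all, so
          \<open>I\<close> itself can be the admissible set.\<close>
        case False
        then obtain e where "e > 0" "ball x e \<subseteq> I - ?K"
          using x open_minus_GG_supp[OF I(1)] openE by blast
        then show ?thesis using NI by blast
      qed
      then obtain S e where S: "N S" "e > 0" "\<And>y. y \<in> ball x e \<Longrightarrow> y \<in> ?K \<Longrightarrow> y \<notin> S" by blast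
      have "f (cut u \<phi>) = f (cut v \<phi>)" if uv: "u \<le> x" "x \<le> v" "v - u < e" for u v
      proof -
        \<comment> \<open>This is the slice of \<open>\<phi>\<close> over
          \<open>u < s \<le> v\<close>, supported in the part of \<open>?K\<close> between
          \<open>u\<close> and \<open>v\<close>.\<close>
        define \<delta> where "\<delta> = (\<lambda>s. 1 * cut u \<phi> s + (-1) * cut v \<phi> s)"
        have \<delta>: "\<delta> \<in> RR I" unfolding \<delta>_def by (rule RR_lincomb[OF I(1) cut cut])
        have "AE s in lebesgue. s \<in> I - {u..v} \<inter> ?K \<longrightarrow> \<delta> s = 0"
          using GG_supp_eq_0_ae[OF I(1) RR_GG[OF \<phi>]]
          by eventually_elim (use uv in \<open>auto simp: \<delta>_def cut_def\<close>)
        then have "GG_supp I \<delta> \<subseteq> {u..v} \<inter> ?K"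
          using compact_imp_closed[OF K(1)] by (intro GG_supp_subset_of_ae[OF I(1)]) auto
        moreover have "{u..v} \<subseteq> ball x e" using uv by (auto simp: dist_real_def)
        ultimately have "GG_supp I \<delta> \<inter> S = {}" using S(3) by blast
        then have "f \<delta> = 0" using S(1) \<delta> by (auto simp: N_def)
        then show ?thesis unfolding \<delta>_def RR_dual_lincomb[OF I(1) f cut cut] by simp
      qed
      then show ?case using S(2) by blast
    qed
    moreover have "ae_eq I (cut A \<phi>) \<phi>" "ae_eq I (cut B \<phi>) (\<lambda>_. 0)"
      unfolding ae_eq_def using GG_supp_eq_0_ae[OF I(1) RR_GG[OF \<phi>]]
      by (eventually_elim; use A B m(2) M(2) in \<open>fastforce simp: cut_def\<close>)+
    ultimately show ?thesis
      using RR_dual_ae_eq[OF f cut \<phi>] RR_dual_ae_eq[OF f cut RR_0[OF I(1)]] RR_dual_0[OF I(1) f]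
      by metis
  qed
  with cl have "N S0" by (auto simp: N_def)
  moreover have "RR_dual_supp I f = S0"
    unfolding RR_dual_supp_def N_def[symmetric]
    by (rule Least_equality) (use \<open>N S0\<close> in \<open>auto simp: S0_def\<close>)
  ultimately show ?thesis by (simp add: N_def)
qed

section \<open>The coefficients on an open interval\<close>

lemma is_interval_einterval: "is_interval (einterval a b)"
  unfolding is_interval_1
proof (intro ballI allI impI)
  fix x y z assume "x \<in> einterval a b" "y \<in> einterval a b" "x \<le> z \<and> z \<le> y"
  then have "a < ereal x" "ereal x \<le> ereal z" "ereal z \<le> ereal y" "ereal y < b"
    by (auto simp: einterval_def)
  then show "z \<in> einterval a b" unfolding einterval_iff by (intro conjI) order+
qed

theorem theorem2p9:
  fixes a b :: ereal and I :: "real set"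
  assumes "a < b" and "I = einterval a b"
  shows "(\<forall>c. \<forall>\<phi>\<in>RR_F I. finite (jump_terms I c \<phi>)) \<and>
    (\<forall>f\<in>ker_Gam I. \<exists>c.
      jump_expansion I f c \<and>
      (\<forall>c'. jump_expansion I f c' \<longrightarrow> (\<forall>k. \<forall>t\<in>I. c' k t = c k t)) \<and>
      (\<forall>t\<in>I. \<exists>k0. \<forall>k\<ge>k0. c k t = 0) \<and>
      (\<forall>t\<in>I - RR_dual_supp I f. \<forall>k. c k t = 0))"
proof -
  have I: "open I" "is_interval I"
    using assms(2) by (simp_all add: is_interval_einterval)
  show ?thesis
  proof (intro conjI ballI allI)
    fix c \<phi> assume "\<phi> \<in> RR_F I"
    then show "finite (jump_terms I c \<phi>)"
      using finite_subset[OF jump_terms_subset finite_jumps[OF I(1)]] by blast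
  next
    fix f assume f: "f \<in> ker_Gam I"
    then have fd: "f \<in> RR_dual I" by (simp add: ker_Gam_def)
    obtain r where r: "\<And>t. t \<in> I \<Longrightarrow> r t > 0 \<and> cball t (2 * r t) \<subseteq> I"
      using ex_cball_double[OF I(1)] by metis
    \<comment> \<open>The radii \<open>r t\<close> are arbitrary admissible ones; by
      \<open>jump_expansion_jump_fun\<close> the resulting coefficients do not depend on
      them.\<close>
    define c where "c k t = f (jump_fun t (r t) k)" for k t
    \<comment> \<open>The functional \<open>f\<close> is its own continuous extension, so only
      agreement with the jump sum on \<open>RR_F I\<close> remains.\<close>
    have exp: "jump_expansion I f c"
      unfolding jump_expansion_def continuous_extension_def
    proof (intro exI[of _ f] conjI ballI fd refl)
      fix \<phi> assume \<phi>: "\<phi> \<in> RR_F I"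
      then have "\<phi> \<in> RR I" by (simp add: RR_F_def)
      from ker_Gam_expansion[OF I(1) f this finite_jumps[OF I(1) \<phi>] r] show "f \<phi> = jump_sum I c \<phi>"
        unfolding jump_sum_eq[OF finite_jumps[OF I(1) \<phi>]] c_def .
    qed
    have supp: "c k t = 0" if t: "t \<in> I - RR_dual_supp I f" for k t
    proof -
      note S = RR_dual_supp[OF I fd]
      have "openin (top_of_set I) (I - RR_dual_supp I f)" using S by (auto simp: closedin_def)
      then have "open (I - RR_dual_supp I f)" using I(1) openin_open_eq by blast
      \<comment> \<open>A radius possibly smaller than \<open>r t\<close> is taken, so that the jump
        function is supported off the support of \<open>f\<close>; the coefficient is the
        same.\<close>
      from ex_cball_double[OF this t] obtain \<epsilon> where
        \<epsilon>: "\<epsilon> > 0" "cball t (2 * \<epsilon>) \<subseteq> I" "cball t (2 * \<epsilon>) \<inter> RR_dual_supp I f = {}" by blast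
      have "GG_supp I (jump_fun t \<epsilon> k) \<inter> RR_dual_supp I f = {}"
        using GG_supp_jump_fun[OF I(1) \<epsilon>(1,2), of k] \<epsilon>(3) by blast
      then have "f (jump_fun t \<epsilon> k) = 0" using S jump_fun_RR[OF I(1) \<epsilon>(1,2)] by blast
      then show ?thesis using jump_expansion_jump_fun[OF I(1) exp \<epsilon>(1,2)] by simp
    qed
    show "\<exists>c. jump_expansion I f c \<and>
        (\<forall>c'. jump_expansion I f c' \<longrightarrow> (\<forall>k. \<forall>t\<in>I. c' k t = c k t)) \<and>
        (\<forall>t\<in>I. \<exists>k0. \<forall>k\<ge>k0. c k t = 0) \<and>
        (\<forall>t\<in>I - RR_dual_supp I f. \<forall>k. c k t = 0)"
    proof (intro exI[of _ c] conjI allI impI ballI exp)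
      fix c' k t assume "jump_expansion I f c'" "t \<in> I"
      then show "c' k t = c k t"
        using jump_expansion_jump_fun[OF I(1)] exp r by metis
    qed (use jump_expansion_eventually_0[OF I(1) fd exp] supp in blast)+
  qed
qed

end
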